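(* Let $P\subset\mathbb{R}^d$ be an inscribed polytope. The following are equivalent: (i) $P$ is an (inscribed) zonotope; (ii) for every edge $e$ of $P$, the projection $\pi_e(P)$ is inscribed with center $c(P)$; (iii) for every edge $e$ of $P$, the section $P\cap M_e$ is inscribed with center $c(P)$.
   Context: A convex polytope is inscribed if its vertices lie on a common sphere. For an inscribed polytope $P$, $c(P)\in\operatorname{aff}(P)$ denotes the center of the inscribing sphere relative to the affine hull of $P$, i.e. the unique point of $\operatorname{aff}(P)$ equidistant from all vertices of $P$. "Inscribed with center $c$" for a polytope $Q$ means $Q$ is inscribed and $c(Q)=c$. For a segment $e\subset\mathbb{R}^d$, $M_e$ is the (affine) hyperplane of points equidistant to the two endpoints of $e$, and $\pi_e:\mathbb{R}^d\to M_e$ is the orthogonal projection onto $M_e$. A zonotope is a translate of a Minkowski sum of finitely many segments $[-z_1,z_1]+\cdots+[-z_n,z_n]$. *)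

theory Defs
  imports "HOL-Analysis.Analysis"
begin

text \<open>Polytopes are understood to be nonempty, whereas the library predicate
  \<^const>\<open>polytope\<close> also holds of the empty set.\<close>

definition inscribed :: "'a::euclidean_space set \<Rightarrow> bool" where
  "inscribed P \<longleftrightarrow> polytope P \<and> P \<noteq> {} \<and>
     (\<exists>c r. {v. v extreme_point_of P} \<subseteq> sphere c r)"

text \<open>The inscribing sphere in the ambient space is in general not unique, but for inscribed
  \<open>P\<close> exactly one admissible center lies in the affine hull. A single point is its own
  center, with radius 0.\<close>

definition circumcenter :: "'a::euclidean_space set \<Rightarrow> 'a" where
  "circumcenter P = (THE c. c \<in> affine hull P \<and>
     (\<exists>r. {v. v extreme_point_of P} \<subseteq> sphere c r))"

definition inscribed_with_center :: "'a::euclidean_space set \<Rightarrow> 'a \<Rightarrow> bool" where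
  "inscribed_with_center Q c \<longleftrightarrow> inscribed Q \<and> circumcenter Q = c"

text \<open>Only meaningful for nondegenerate segments \<open>e\<close>, such as the edges of a polytope. The two
  endpoints of a segment are determined by it up to order, so the quantifier is harmless.\<close>

definition bisector :: "'a::euclidean_space set \<Rightarrow> 'a set" where
  "bisector e = {x. \<forall>a b. e = closed_segment a b \<longrightarrow> dist x a = dist x b}"

definition orth_proj :: "'a::euclidean_space set \<Rightarrow> 'a \<Rightarrow> 'a" where
  "orth_proj M x = (THE y. y \<in> M \<and> (\<forall>u\<in>M. orthogonal (x - y) (u - y)))"

text \<open>The sum over the list is the Minkowski sum of sets; for the empty list it is \<open>{0}\<close>, so a
  single point is a zonotope.\<close>

definition zonotope :: "'a::euclidean_space set \<Rightarrow> bool" where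
  "zonotope Z \<longleftrightarrow>
     (\<exists>t zs. Z = (+) t ` (\<Sum>z\<leftarrow>zs. closed_segment (- z) z))"

end

theory Submission
  imports Defs
begin

text \<open>If \<open>P\<close> is a zonotope, every edge is a Minkowski summand of \<open>P\<close>. The fiber of \<open>\<pi>\<^sub>e\<close> over a
  vertex of \<open>\<pi>\<^sub>e(P)\<close> is again an edge, parallel to \<open>e\<close> and, by comparing the two summands, of the same
  length; its midpoint lies on \<open>M\<^sub>e\<close>. So \<open>\<pi>\<^sub>e(P) = P \<inter> M\<^sub>e\<close> and the distance of all vertices of this set
  to the center is determined by the radius and the length of \<open>e\<close>.

  Conversely, (ii) says that the open slab of width \<open>|e|\<close> around \<open>M\<^sub>e\<close> contains no vertex of \<open>P\<close>, and
  (iii) that all vertices of \<open>P \<inter> M\<^sub>e\<close> are as far from the center as the midpoint of \<open>e\<close>. Both conditions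
  pass to two-dimensional faces, where either of them forces central symmetry. Symmetry of the
  two-dimensional faces implies that for every edge \<open>e\<close> and every \<open>u\<close> orthogonal to \<open>e\<close> the face of \<open>P\<close>
  maximizing \<open>u\<close> contains a translate of \<open>e\<close>: by induction on the dimension, the set of such nonzero
  \<open>u\<close> is open and closed in a punctured linear space of dimension at least 2. Hence \<open>e\<close> is a summand,
  and splitting off one edge after the other exhibits \<open>P\<close> as a zonotope.\<close>

section \<open>Exposed faces as sets of maximizers\<close>

text \<open>The notion that survives every reduction is \<open>zonal\<close>. It treats edges as
  vectors, lengths included, and mentions neither a center nor a symmetry. The lengths make the
  splitting terminate: zonality forces parallel edges to be equally long, so nothing parallel to a
  removed edge is left over and the set of edge vectors shrinks. Polygons need an argument of their
  own, because within their plane the directions orthogonal to an edge form a line, which becomes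
  disconnected without the origin. The link between an edge and the center is that the bisector of a
  chord passes through the center of the sphere, so \<open>M_e\<close> depends on \<open>e\<close>
  only through its direction.\<close>

lemma polytope_subset_if_extreme:
  fixes P :: "'a::euclidean_space set"
  assumes "polytope P" "convex S" "\<And>x. x extreme_point_of P \<Longrightarrow> x \<in> S"
  shows "P \<subseteq> S"
proof -
  have "convex hull {x. x extreme_point_of P} \<subseteq> S" using assms by (intro hull_minimal) auto
  with Krein_Milman_Minkowski[OF polytope_imp_compact polytope_imp_convex, OF assms(1,1)]
  show ?thesis by (rule ord_eq_le_trans)
qed

text \<open>The exposed face in direction \<open>u\<close>; for \<open>u = 0\<close> it is all of
  \<open>P\<close>. Indexing faces by directions allows tilting a direction, moving it continuously,
  and splitting a face over a Minkowski sum.\<close>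

definition maxface :: "'a::euclidean_space set \<Rightarrow> 'a \<Rightarrow> 'a set" where
  "maxface P u = {x \<in> P. \<forall>y\<in>P. u \<bullet> y \<le> u \<bullet> x}"

lemma maxface_subset: "maxface P u \<subseteq> P"
  by (auto simp: maxface_def)

lemma inner_maxface_eq: "x \<in> maxface P u \<Longrightarrow> y \<in> maxface P u \<Longrightarrow> u \<bullet> x = u \<bullet> y"
  by (force simp: maxface_def)

lemma maxface_memI: "x \<in> maxface P u \<Longrightarrow> y \<in> P \<Longrightarrow> u \<bullet> x \<le> u \<bullet> y \<Longrightarrow> y \<in> maxface P u"
  by (force simp: maxface_def)

lemma maxface_eq_self: "(\<And>x. x \<in> P \<Longrightarrow> u \<bullet> x = c) \<Longrightarrow> maxface P u = P"
  by (auto simp: maxface_def)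

lemma maxface_nonempty:
  assumes "compact P" "P \<noteq> {}"
  shows "maxface P u \<noteq> {}"
proof -
  have "continuous_on P (\<lambda>x. u \<bullet> x)" by (intro continuous_intros)
  from continuous_attains_sup[OF assms this] show ?thesis
    by (auto simp: maxface_def)
qed

lemma maxface_face_of:
  assumes "convex P"
  shows "maxface P u face_of P"
proof (cases "maxface P u = {}")
  case False
  then obtain x where x: "x \<in> maxface P u" by blast
  then have "maxface P u = P \<inter> {y. u \<bullet> y = u \<bullet> x}"
    by (force simp: maxface_def)
  moreover have "(P \<inter> {y. u \<bullet> y = u \<bullet> x}) face_of P"
    using x by (intro face_of_Int_supporting_hyperplane_le assms) (auto simp: maxface_def)
  ultimately show ?thesis by simp
qed auto

lemma polytope_face_eq_maxface:
  assumes "polytope P" "F face_of P" "F \<noteq> {}"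
  obtains u where "F = maxface P u"
proof -
  have "F exposed_face_of P"
    using assms exposed_face_of_polyhedron polytope_imp_polyhedron by blast
  then obtain u b where u: "P \<subseteq> {x. u \<bullet> x \<le> b}" "F = P \<inter> {x. u \<bullet> x = b}"
    unfolding exposed_face_of_def by blast
  obtain w where "w \<in> F" using assms by blast
  then have "F = maxface P u"
    using u by (force simp: maxface_def)
  then show thesis by (rule that)
qed

lemma polytope_maxface: "polytope P \<Longrightarrow> polytope (maxface P u)"
  using face_of_polytope_polytope maxface_face_of polytope_imp_convex by blast

text \<open>The two summands of a point vary independently, so \<open>u\<close> is maximal on a sum
  exactly when it is maximal on both summands.\<close>

lemma maxface_plus:
  assumes "compact A" "compact B"
  shows "maxface (A + B) u = maxface A u + maxface B u"
proof (rule set_eqI, rule iffI)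
  fix x assume x: "x \<in> maxface (A + B) u"
  then obtain a b where ab: "a \<in> A" "b \<in> B" "x = a + b"
    by (auto simp: maxface_def set_plus_def)
  have le: "u \<bullet> (a' + b') \<le> u \<bullet> (a + b)" if "a' \<in> A" "b' \<in> B" for a' b'
    using x ab that by (auto simp: maxface_def set_plus_def)
  have "a \<in> maxface A u" using le[OF _ ab(2)] ab by (auto simp: maxface_def inner_add_right)
  moreover have "b \<in> maxface B u" using le[OF ab(1)] ab by (auto simp: maxface_def inner_add_right)
  ultimately show "x \<in> maxface A u + maxface B u" using ab by (auto simp: set_plus_def)
qed (force simp: maxface_def set_plus_def inner_add_right intro: add_mono)

lemma maxface_maxface:
  assumes "maxface P v \<subseteq> maxface P u" "maxface P v \<noteq> {}"
  shows "maxface (maxface P u) v = maxface P v"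
proof
  obtain w where w: "w \<in> maxface P v" using assms by blast
  show "maxface (maxface P u) v \<subseteq> maxface P v"
  proof
    fix x assume "x \<in> maxface (maxface P u) v"
    then have "x \<in> P" "v \<bullet> w \<le> v \<bullet> x" using w assms by (auto simp: maxface_def)
    then show "x \<in> maxface P v" using w maxface_memI by blast
  qed
  show "maxface P v \<subseteq> maxface (maxface P u) v"
    using assms(1) maxface_subset[of P u] by (auto simp: maxface_def[of _ v])
qed

text \<open>Only finitely many vertices lie outside the face of \<open>u\<close>, and each is
  strictly worse than \<open>p\<close> in direction \<open>u\<close>. These strict inequalities
  survive a small change of direction.\<close>

lemma maxface_upper_semicontinuous:
  assumes "polytope P"
  obtains W where "open W" "u \<in> W" "\<And>v. v \<in> W \<Longrightarrow> maxface P v \<subseteq> maxface P u"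
proof (cases "P = {}")
  case True
  then show ?thesis using that[of UNIV] by (auto simp: maxface_def)
next
  case False
  obtain p where p: "p \<in> maxface P u"
    using maxface_nonempty[of P u] False assms polytope_imp_compact by blast
  define V where "V = {v. v extreme_point_of P}"
  have fin: "finite V"
    unfolding V_def using assms finite_polyhedron_extreme_points polytope_imp_polyhedron by blast
  define W where "W = (\<Inter>x\<in>V - maxface P u. {v. v \<bullet> (x - p) < 0})"
  show ?thesis
  proof (rule that)
    show "open W" unfolding W_def using fin
      by (intro open_INT ballI open_Collect_less continuous_intros) auto
    have lt: "u \<bullet> x < u \<bullet> p" if "x \<in> V - maxface P u" for x
    proof -
      have "x \<in> P" using that by (auto simp: V_def extreme_point_of_def)
      with that maxface_memI[OF p] show ?thesis by force
    qed
    show "u \<in> W" using lt by (auto simp: W_def inner_diff_right)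
    fix v assume v: "v \<in> W"
    have face: "maxface P v face_of P"
      using assms maxface_face_of polytope_imp_convex by blast
    show "maxface P v \<subseteq> maxface P u"
    proof (rule polytope_subset_if_extreme[OF polytope_maxface[OF assms]])
      show "convex (maxface P u)" by (rule polytope_imp_convex[OF polytope_maxface[OF assms]])
      fix x assume "x extreme_point_of maxface P v"
      then have x: "x extreme_point_of P" "x \<in> maxface P v"
        using extreme_point_of_face[OF face] by auto
      have "v \<bullet> p \<le> v \<bullet> x" using x p by (auto simp: maxface_def)
      moreover have "v \<bullet> (x - p) < 0" if "x \<notin> maxface P u"
        using v x that by (auto simp: W_def V_def)
      ultimately show "x \<in> maxface P u" by (auto simp: inner_diff_right)
    qed
  qed
qed

text \<open>Tilting refines lexicographically: a small tilt keeps the maximizers inside the face of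
  \<open>u\<close>, where \<open>u\<close> is constant and only \<open>d\<close> decides.\<close>

lemma maxface_perturb:
  assumes "polytope P" "P \<noteq> {}"
  obtains \<epsilon> where "\<epsilon> > 0" "\<And>t. 0 < t \<Longrightarrow> t < \<epsilon> \<Longrightarrow> maxface P (u + t *\<^sub>R d) = maxface (maxface P u) d"
proof -
  obtain W where W: "open W" "u \<in> W" "\<And>v. v \<in> W \<Longrightarrow> maxface P v \<subseteq> maxface P u"
    using maxface_upper_semicontinuous[OF assms(1)] by metis
  have "open ((\<lambda>t. u + t *\<^sub>R d) -` W)"
    using W by (intro open_vimage continuous_intros) auto
  moreover have "0 \<in> (\<lambda>t. u + t *\<^sub>R d) -` W" using W by simp
  ultimately obtain \<epsilon> where e: "\<epsilon> > 0" "\<And>t. dist t 0 < \<epsilon> \<Longrightarrow> t \<in> (\<lambda>t. u + t *\<^sub>R d) -` W"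
    unfolding open_dist by meson
  show ?thesis
  proof (rule that[OF e(1)])
    fix t :: real assume t: "0 < t" "t < \<epsilon>"
    have "maxface P (u + t *\<^sub>R d) = maxface (maxface P u) (u + t *\<^sub>R d)"
      using e(2)[of t] W(3) t maxface_nonempty[OF polytope_imp_compact[OF assms(1)] assms(2)]
      by (intro maxface_maxface[symmetric]) (auto simp: dist_real_def)
    also have "\<dots> = maxface (maxface P u) d"
    proof -
      have "(u + t *\<^sub>R d) \<bullet> y \<le> (u + t *\<^sub>R d) \<bullet> x \<longleftrightarrow> d \<bullet> y \<le> d \<bullet> x"
        if "x \<in> maxface P u" "y \<in> maxface P u" for x y
        using inner_maxface_eq[OF that] t by (simp add: inner_add_left)
      then show ?thesis unfolding maxface_def[of "maxface P u"] by blast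
    qed
    finally show "maxface P (u + t *\<^sub>R d) = maxface (maxface P u) d" .
  qed
qed

section \<open>Edges\<close>

lemma polytope_edge_segment:
  assumes "polytope P" "e edge_of P"
  obtains a b where "a \<noteq> b" "e = closed_segment a b"
proof -
  have e: "polytope e" "aff_dim e = 1"
    using assms face_of_polytope_polytope by (auto simp: edge_of_def)
  then have "e \<noteq> {}" by auto
  have "collinear e" using e by (simp add: collinear_aff_dim)
  then obtain a b where ab: "e = closed_segment a b"
    using compact_convex_collinear_segment e \<open>e \<noteq> {}\<close> polytope_imp_compact polytope_imp_convex
    by metis
  moreover have "a \<noteq> b" using e ab by auto
  ultimately show thesis using that by blast
qed

lemma segment_edge_of_iff:
  "closed_segment a b edge_of P \<longleftrightarrow> a \<noteq> b \<and> closed_segment a b face_of P"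
proof -
  have "aff_dim (closed_segment a b) = (if a = b then 0 else 1)"
    by (auto simp: segment_convex_hull aff_dim_convex_hull)
  then show ?thesis by (auto simp: edge_of_def)
qed

lemma edge_endpoints_extreme:
  assumes "closed_segment a b edge_of P"
  shows "a extreme_point_of P" "b extreme_point_of P"
  using assms extreme_point_of_face[of "closed_segment a b" P] extreme_point_of_segment
  by (auto simp: edge_of_def)

text \<open>Vectors rather than segments, since an edge matters up to translation but with its
  length. With \<open>z\<close> also \<open>- z\<close> belongs to the set.\<close>

definition edge_vectors :: "'a::euclidean_space set \<Rightarrow> 'a set" where
  "edge_vectors P = {z. \<exists>x. closed_segment x (x + z) edge_of P}"

lemma edge_vectors_iff:
  assumes "polytope P"
  shows "z \<in> edge_vectors P \<longleftrightarrow> z \<noteq> 0 \<and> (\<exists>u x. maxface P u = closed_segment x (x + z))"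
proof
  assume "z \<in> edge_vectors P"
  then obtain x where x: "closed_segment x (x + z) edge_of P" by (auto simp: edge_vectors_def)
  then have "z \<noteq> 0" "closed_segment x (x + z) face_of P" by (auto simp: segment_edge_of_iff)
  moreover obtain u where "closed_segment x (x + z) = maxface P u"
    using polytope_face_eq_maxface[OF assms calculation(2)] by auto
  ultimately show "z \<noteq> 0 \<and> (\<exists>u x. maxface P u = closed_segment x (x + z))" by metis
next
  assume "z \<noteq> 0 \<and> (\<exists>u x. maxface P u = closed_segment x (x + z))"
  then obtain u x where "z \<noteq> 0" "maxface P u = closed_segment x (x + z)" by blast
  then have "closed_segment x (x + z) edge_of P"
    using maxface_face_of[of P u] assms polytope_imp_convex by (auto simp: segment_edge_of_iff)
  then show "z \<in> edge_vectors P" by (auto simp: edge_vectors_def)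
qed

lemma finite_edge_vectors:
  assumes "polytope P"
  shows "finite (edge_vectors P)"
proof -
  let ?V = "{v. v extreme_point_of P}"
  have "finite ?V"
    using assms finite_polyhedron_extreme_points polytope_imp_polyhedron by blast
  then have "finite ((\<lambda>(x, y). y - x) ` (?V \<times> ?V))" by blast
  moreover have "edge_vectors P \<subseteq> (\<lambda>(x, y). y - x) ` (?V \<times> ?V)"
    using edge_endpoints_extreme by (force simp: edge_vectors_def image_iff)
  ultimately show ?thesis by (rule rev_finite_subset)
qed

lemma inner_edge_vector_eq_0:
  assumes "closed_segment x (x + z) \<subseteq> maxface P u"
  shows "u \<bullet> z = 0"
proof -
  have "x \<in> maxface P u" "x + z \<in> maxface P u" using assms by auto
  from inner_maxface_eq[OF this] show ?thesis by (simp add: inner_add_right)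
qed

text \<open>Every vertex of the projection of \<open>P\<close> along an edge lies below a translate of that edge.\<close>

definition zonal :: "'a::euclidean_space set \<Rightarrow> bool" where
  "zonal P \<longleftrightarrow> (\<forall>z\<in>edge_vectors P. \<forall>u. u \<bullet> z = 0 \<longrightarrow>
     (\<exists>x. closed_segment x (x + z) edge_of P \<and> closed_segment x (x + z) \<subseteq> maxface P u))"

section \<open>Peeling off segments\<close>

lemma closed_segment_plus_parallel:
  fixes z :: "'a::real_vector"
  assumes "0 \<le> s" "0 \<le> t"
  shows "closed_segment a (a + s *\<^sub>R z) + closed_segment b (b + t *\<^sub>R z)
         = closed_segment (a + b) (a + b + (s + t) *\<^sub>R z)"
proof -
  have seg: "closed_segment c (c + r *\<^sub>R z) = {c + k *\<^sub>R z |k. 0 \<le> k \<and> k \<le> r}"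
    if "0 \<le> r" for c :: 'a and r
  proof
    show "closed_segment c (c + r *\<^sub>R z) \<subseteq> {c + k *\<^sub>R z |k. 0 \<le> k \<and> k \<le> r}"
    proof
      fix x assume "x \<in> closed_segment c (c + r *\<^sub>R z)"
      then obtain m where "0 \<le> m" "m \<le> 1" "x = (1 - m) *\<^sub>R c + m *\<^sub>R (c + r *\<^sub>R z)"
        by (auto simp: in_segment)
      then show "x \<in> {c + k *\<^sub>R z |k. 0 \<le> k \<and> k \<le> r}"
        using that
        by (intro CollectI exI[of _ "m * r"]) (auto simp: algebra_simps mult_left_le_one_le)
    qed
    show "{c + k *\<^sub>R z |k. 0 \<le> k \<and> k \<le> r} \<subseteq> closed_segment c (c + r *\<^sub>R z)"
    proof clarify
      fix k assume k: "0 \<le> k" "k \<le> r"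
      show "c + k *\<^sub>R z \<in> closed_segment c (c + r *\<^sub>R z)"
      proof (cases "r = 0")
        case False
        then show ?thesis unfolding in_segment
          using k that by (intro exI[of _ "k / r"]) (auto simp: algebra_simps)
      qed (use k in auto)
    qed
  qed
  show ?thesis
    unfolding seg[OF assms(1)] seg[OF assms(2)] seg[OF add_nonneg_nonneg[OF assms]]
  proof (intro equalityI subsetI)
    fix x assume "x \<in> {a + k *\<^sub>R z |k. 0 \<le> k \<and> k \<le> s} + {b + k *\<^sub>R z |k. 0 \<le> k \<and> k \<le> t}"
    then obtain i j where "0 \<le> i" "i \<le> s" "0 \<le> j" "j \<le> t" "x = a + i *\<^sub>R z + (b + j *\<^sub>R z)"
      by (auto simp: set_plus_def)
    then show "x \<in> {a + b + k *\<^sub>R z |k. 0 \<le> k \<and> k \<le> s + t}"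
      by (intro CollectI exI[of _ "i + j"]) (auto simp: algebra_simps)
  next
    fix x assume "x \<in> {a + b + k *\<^sub>R z |k. 0 \<le> k \<and> k \<le> s + t}"
    then obtain k where k: "0 \<le> k" "k \<le> s + t" "x = a + b + k *\<^sub>R z" by blast
    have "a + min k s *\<^sub>R z \<in> {a + k *\<^sub>R z |k. 0 \<le> k \<and> k \<le> s}"
      "b + (k - min k s) *\<^sub>R z \<in> {b + k *\<^sub>R z |k. 0 \<le> k \<and> k \<le> t}"
      using k assms by auto
    from set_plus_intro[OF this]
    show "x \<in> {a + k *\<^sub>R z |k. 0 \<le> k \<and> k \<le> s} + {b + k *\<^sub>R z |k. 0 \<le> k \<and> k \<le> t}"
      using k by (simp add: algebra_simps)
  qed
qed

lemma norm_le_if_segment_subset: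
  fixes v :: "'a::euclidean_space"
  assumes "closed_segment a (a + v) \<subseteq> closed_segment b (b + w)"
  shows "norm v \<le> norm w"
proof -
  have "a \<in> closed_segment b (b + w)" "a + v \<in> closed_segment b (b + w)" using assms by auto
  then obtain s t where st: "0 \<le> s" "s \<le> 1" "0 \<le> t" "t \<le> 1"
      "a = b + s *\<^sub>R w" "a + v = b + t *\<^sub>R w"
    by (auto simp: in_segment algebra_simps)
  then have "v = (t - s) *\<^sub>R w" by (simp add: algebra_simps)
  moreover have "\<bar>t - s\<bar> \<le> 1" using st by auto
  ultimately show ?thesis by (simp add: mult_left_le_one_le)
qed

lemma maxface_segment:
  assumes "u \<bullet> z \<noteq> 0"
  obtains \<zeta> where "\<zeta> \<in> closed_segment 0 z" "maxface (closed_segment 0 z) u = {\<zeta>}"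
proof -
  have seg: "closed_segment 0 z = {k *\<^sub>R z |k. 0 \<le> k \<and> k \<le> 1}"
    by (auto simp: in_segment)
  show thesis
  proof (cases "u \<bullet> z > 0")
    case True
    have "maxface (closed_segment 0 z) u = {z}"
    proof
      show "maxface (closed_segment 0 z) u \<subseteq> {z}"
      proof
        fix x assume x: "x \<in> maxface (closed_segment 0 z) u"
        then obtain k where k: "x = k *\<^sub>R z" "k \<le> 1" by (auto simp: maxface_def seg)
        have "u \<bullet> z \<le> u \<bullet> x" using x by (auto simp: maxface_def)
        then have "1 \<le> k" using k True by simp
        then show "x \<in> {z}" using k by simp
      qed
    qed (use True in \<open>auto simp: maxface_def seg intro: exI[of _ 1]\<close>)
    then show thesis using that[of z] by auto
  next
    case False
    then have neg: "u \<bullet> z < 0" using assms by auto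
    have "maxface (closed_segment 0 z) u = {0}"
    proof
      show "maxface (closed_segment 0 z) u \<subseteq> {0}"
      proof
        fix x assume x: "x \<in> maxface (closed_segment 0 z) u"
        then obtain k where k: "x = k *\<^sub>R z" "0 \<le> k" by (auto simp: maxface_def seg)
        have "u \<bullet> 0 \<le> u \<bullet> x" using x unfolding maxface_def by blast
        then have "k = 0" using k neg by (simp add: zero_le_mult_iff)
        then show "x \<in> {0}" using k by simp
      qed
    qed (use neg in \<open>auto simp: maxface_def seg mult_nonneg_nonpos intro: exI[of _ 0]\<close>)
    then show thesis using that[of 0] by auto
  qed
qed

lemma maxface_segment_orthogonal:
  assumes "u \<bullet> z = 0"
  shows "maxface (closed_segment 0 z) u = closed_segment 0 z"
proof -
  have "u \<bullet> x = 0" if "x \<in> closed_segment 0 z" for x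
    using that assms by (auto simp: in_segment)
  then show ?thesis by (rule maxface_eq_self)
qed

text \<open>\<open>Q\<close> collects the starting points of all translates of \<open>[0, z]\<close>
  in \<open>P\<close>. A point of \<open>P\<close> outside the cylinder over \<open>Q\<close> in
  direction \<open>z\<close> could be separated from it by a hyperplane parallel to
  \<open>z\<close>; but zonality puts a starting point into the face of \<open>P\<close> that lies
  farthest on that side.\<close>

lemma zonal_summand:
  assumes P: "polytope P" "zonal P" and z: "z \<in> edge_vectors P"
  obtains Q where "polytope Q" "Q \<noteq> {}" "P = Q + closed_segment 0 z"
proof -
  define Q where "Q = P \<inter> (+) (- z) ` P"
  have Q_iff: "q \<in> Q \<longleftrightarrow> q \<in> P \<and> q + z \<in> P" for q
    by (force simp: Q_def image_iff algebra_simps)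
  have Q: "polytope Q" unfolding Q_def using P(1) polytope_translation_eq polytope_Int by blast
  have convP: "convex P" using P polytope_imp_convex by blast
  have edge_Q: "x \<in> Q" if "closed_segment x (x + z) \<subseteq> P" for x
    using that Q_iff by auto
  obtain x0 where "closed_segment x0 (x0 + z) edge_of P" using z by (auto simp: edge_vectors_def)
  then have "Q \<noteq> {}" using edge_Q edge_of_imp_subset by blast
  define K where "K = {q + y |q y. q \<in> Q \<and> y \<in> span {z}}"
  have "K = (\<Union>x\<in>Q. \<Union>y\<in>span {z}. {x + y})" unfolding K_def by blast
  then have K: "closed K"
    using compact_closed_sums[OF polytope_imp_compact[OF Q] closed_span] by simp
  have "K = Q + span {z}" unfolding K_def set_plus_def by blast
  then have convK: "convex K"
    using convex_set_plus[OF polytope_imp_convex[OF Q] subspace_imp_convex[OF subspace_span]] by simp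
  have PK: "P \<subseteq> K"
  proof (rule subsetI, rule ccontr)
    fix x assume x: "x \<in> P" "x \<notin> K"
    obtain a b where ab: "a \<bullet> x < b" "\<forall>k\<in>K. a \<bullet> k > b"
      using separating_hyperplane_closed_point[OF convK K x(2)] by auto
    \<comment> \<open>\<open>K\<close> contains full lines in direction \<open>z\<close>, on which
      \<open>a\<close> can be bounded below only if it is constant.\<close>
    have "a \<bullet> z = 0"
    proof (rule ccontr)
      assume nz: "a \<bullet> z \<noteq> 0"
      obtain q where q: "q \<in> Q" using \<open>Q \<noteq> {}\<close> by blast
      let ?t = "(b - a \<bullet> q) / (a \<bullet> z)"
      have "q + ?t *\<^sub>R z \<in> K" using q by (auto simp: K_def span_singleton)
      then have "a \<bullet> (q + ?t *\<^sub>R z) > b" using ab by blast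
      then show False using nz by (simp add: inner_add_right)
    qed
    then have "- a \<bullet> z = 0" by simp
    then obtain y where y: "closed_segment y (y + z) edge_of P"
        "closed_segment y (y + z) \<subseteq> maxface P (- a)"
      using P z unfolding zonal_def by blast
    then have "y \<in> Q" "y \<in> maxface P (- a)" using edge_Q[OF edge_of_imp_subset[OF y(1)]] by auto
    moreover have "y \<in> K" using \<open>y \<in> Q\<close> span_zero unfolding K_def by force
    ultimately show False using ab x by (force simp: maxface_def)
  qed
  have "x \<in> Q + closed_segment 0 z" if x: "x \<in> P" for x
  proof -
    obtain q t where qt: "q \<in> Q" "x = q + t *\<^sub>R z"
      using PK x unfolding K_def span_singleton by blast
    then have qP: "q \<in> P" "q + z \<in> P" using Q_iff by auto
    consider "t < 0" | "0 \<le> t" "t \<le> 1" | "t > 1" by linarith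
    then show ?thesis
    proof cases
      \<comment> \<open>\<open>x + z\<close> lies between \<open>x\<close> and \<open>q + z\<close>,
        so \<open>x\<close> itself belongs to \<open>Q\<close>.\<close>
      case 1
      have "(1 - 1 / (1 - t)) *\<^sub>R x + (1 / (1 - t)) *\<^sub>R (q + z) \<in> P"
        using 1 by (intro convexD[OF convP x qP(2)]) auto
      moreover have "(1 - 1 / (1 - t)) *\<^sub>R x + (1 / (1 - t)) *\<^sub>R (q + z)
          = q + ((1 - 1 / (1 - t)) * t + 1 / (1 - t)) *\<^sub>R z"
        unfolding qt by (simp add: algebra_simps)
      moreover have "(1 - 1 / (1 - t)) * t + 1 / (1 - t) = 1 + t"
        using 1 by (simp add: field_simps)
      ultimately have "x + z \<in> P" by (simp add: qt algebra_simps)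
      then have "x \<in> Q" using x Q_iff by blast
      then show ?thesis using set_plus_intro[of x Q 0] by simp
    next
      case 2
      then have "t *\<^sub>R z \<in> closed_segment 0 z" by (auto simp: in_segment)
      then show ?thesis using qt by (auto intro: set_plus_intro)
    next
      \<comment> \<open>\<open>x - z\<close> lies between \<open>q\<close> and \<open>x\<close>, so
        it is a starting point that carries \<open>x\<close>.\<close>
      case 3
      have "(1 - (t - 1) / t) *\<^sub>R q + ((t - 1) / t) *\<^sub>R x \<in> P"
        using 3 by (intro convexD[OF convP qP(1) x]) auto
      moreover have "(1 - (t - 1) / t) *\<^sub>R q + ((t - 1) / t) *\<^sub>R x = x - z"
        using 3 unfolding qt by (simp add: algebra_simps diff_divide_distrib)
      ultimately have "x - z \<in> Q" using x Q_iff by simp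
      then show ?thesis using set_plus_intro[of "x - z" Q z] by simp
    qed
  qed
  moreover have "q + y \<in> P" if qy: "q \<in> Q" "y \<in> closed_segment 0 z" for q y
  proof -
    obtain k where k: "0 \<le> k" "k \<le> 1" "y = k *\<^sub>R z" using qy by (auto simp: in_segment)
    have "(1 - k) *\<^sub>R q + k *\<^sub>R (q + z) \<in> P"
      using k qy Q_iff by (intro convexD[OF convP]) auto
    then show ?thesis using k by (simp add: algebra_simps)
  qed
  ultimately have "P = Q + closed_segment 0 z" by (auto simp: set_plus_def)
  with Q \<open>Q \<noteq> {}\<close> show thesis by (rule that)
qed

section \<open>What is left after splitting off one edge\<close>

locale peeled =
  fixes P Q :: "'a::euclidean_space set" and z
  assumes polytope_P: "polytope P" and polytope_Q: "polytope Q" and Q_nonempty: "Q \<noteq> {}"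
    and P_eq: "P = Q + closed_segment 0 z" and zonal_P: "zonal P" and z: "z \<in> edge_vectors P"
begin

lemma maxface_P: "maxface P u = maxface Q u + maxface (closed_segment 0 z) u"
  using maxface_plus[of Q "closed_segment 0 z"] polytope_Q polytope_imp_compact P_eq by auto

lemma z_nonzero: "z \<noteq> 0"
  using edge_vectors_iff[OF polytope_P] z by auto

text \<open>Adding \<open>[0, z]\<close> would turn such an edge of \<open>Q\<close> into an edge of
  \<open>P\<close> that is parallel to \<open>z\<close> but longer. Zonality would place a translate
  of it in a face that is an edge with vector \<open>z\<close>, where it does not fit.\<close>

lemma edge_vector_not_parallel:
  assumes y: "y \<noteq> 0" and u: "maxface Q u = closed_segment x (x + y)" and uz: "u \<bullet> z = 0"
  shows "y \<noteq> s *\<^sub>R z"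
proof
  assume s: "y = s *\<^sub>R z"
  then have "s \<noteq> 0" using y by auto
  obtain x' where x': "maxface Q u = closed_segment x' (x' + \<bar>s\<bar> *\<^sub>R z)"
  proof (cases "s \<ge> 0")
    case False
    then have "maxface Q u = closed_segment (x + y) (x + y + \<bar>s\<bar> *\<^sub>R z)"
      using u s by (simp add: closed_segment_commute)
    then show thesis by (rule that)
  qed (use u s that in auto)
  have "maxface P u = closed_segment x' (x' + (\<bar>s\<bar> + 1) *\<^sub>R z)"
    using closed_segment_plus_parallel[of "\<bar>s\<bar>" 1 x' z 0]
    unfolding maxface_P x' maxface_segment_orthogonal[OF uz] by simp
  then have "(\<bar>s\<bar> + 1) *\<^sub>R z \<in> edge_vectors P"
    using z_nonzero unfolding edge_vectors_iff[OF polytope_P] by auto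
  moreover obtain u0 x0 where u0: "maxface P u0 = closed_segment x0 (x0 + z)"
    using z edge_vectors_iff[OF polytope_P] by auto
  moreover have "u0 \<bullet> z = 0" using inner_edge_vector_eq_0[of x0 z P u0] u0 by auto
  ultimately obtain x1 where "closed_segment x1 (x1 + (\<bar>s\<bar> + 1) *\<^sub>R z) \<subseteq> closed_segment x0 (x0 + z)"
    using zonal_P unfolding zonal_def by (metis inner_scaleR_right mult_zero_right)
  from norm_le_if_segment_subset[OF this] have "(\<bar>s\<bar> + 1) * norm z \<le> norm z" by simp
  then show False using z_nonzero \<open>s \<noteq> 0\<close> by (simp add: algebra_simps mult_le_0_iff)
qed

text \<open>A direction not orthogonal to \<open>z\<close> picks a single point of
  \<open>[0, z]\<close>, so the face of \<open>Q\<close> and that of \<open>P\<close> differ only by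
  a translation. Such directions carry edges from one polytope to the other.\<close>

lemma edge_vector_exposed:
  assumes "y \<in> edge_vectors Q"
  obtains u x where "maxface Q u = closed_segment x (x + y)" "u \<bullet> z \<noteq> 0" "u \<bullet> y = 0" "y \<noteq> 0"
proof -
  obtain u x where y: "y \<noteq> 0" and u: "maxface Q u = closed_segment x (x + y)"
    using assms edge_vectors_iff[OF polytope_Q] by auto
  have uy: "u \<bullet> y = 0" using inner_edge_vector_eq_0[of x y Q u] u by auto
  show thesis
  proof (cases "u \<bullet> z = 0")
    case False
    with u uy y that show thesis by blast
  next
    case True
    \<comment> \<open>\<open>d\<close> is the component of \<open>z\<close> orthogonal to
      \<open>y\<close>: tilting along it keeps the whole edge, and
      \<open>d \<bullet> z = d \<bullet> d\<close> is positive unless \<open>z\<close> is parallel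
      to \<open>y\<close>.\<close>
    define k where "k = (z \<bullet> y) / (y \<bullet> y)"
    define d where "d = z - k *\<^sub>R y"
    have dy: "d \<bullet> y = 0" using y by (simp add: d_def k_def inner_diff_left)
    have "d \<noteq> 0"
    proof
      assume "d = 0"
      then have eq: "z = k *\<^sub>R y" by (simp add: d_def)
      then have "k \<noteq> 0" using z_nonzero by auto
      then have "y = (1 / k) *\<^sub>R z" using eq by simp
      then show False using edge_vector_not_parallel[OF y u True] by blast
    qed
    moreover have "d \<bullet> z = d \<bullet> d" using dy by (simp add: d_def inner_diff_right)
    ultimately have dz: "d \<bullet> z \<noteq> 0" by simp
    obtain \<epsilon> where e: "\<epsilon> > 0"
      "\<And>t. 0 < t \<Longrightarrow> t < \<epsilon> \<Longrightarrow> maxface Q (u + t *\<^sub>R d) = maxface (maxface Q u) d"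
      using maxface_perturb[OF polytope_Q Q_nonempty] by metis
    let ?u = "u + (\<epsilon> / 2) *\<^sub>R d"
    have "maxface Q ?u = maxface (closed_segment x (x + y)) d" using e u by auto
    also have "\<dots> = closed_segment x (x + y)"
    proof -
      have "d \<bullet> w = d \<bullet> x" if "w \<in> closed_segment x (x + y)" for w
        using that dy by (auto simp: in_segment inner_add_right algebra_simps)
      then show ?thesis by (rule maxface_eq_self)
    qed
    finally show thesis
      using that[of ?u x] e(1) dz dy uy y True by (simp add: inner_add_left)
  qed
qed

text \<open>The inclusion is strict because \<open>z\<close> itself is lost: every edge vector of
  \<open>Q\<close> is orthogonal to some direction to which \<open>z\<close> is not.\<close>

lemma edge_vectors_Q: "edge_vectors Q \<subset> edge_vectors P"
proof -
  have "y \<in> edge_vectors P - {z}" if y: "y \<in> edge_vectors Q" for y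
  proof -
    obtain u x where u: "maxface Q u = closed_segment x (x + y)" "u \<bullet> z \<noteq> 0" "u \<bullet> y = 0" "y \<noteq> 0"
      using edge_vector_exposed[OF y] by metis
    obtain \<zeta> where "maxface (closed_segment 0 z) u = {\<zeta>}" using maxface_segment[OF u(2)] by metis
    then have "maxface P u = closed_segment x (x + y) + {\<zeta>}" using u maxface_P by simp
    also have "\<dots> = closed_segment (x + \<zeta>) (x + \<zeta> + y)"
      using closed_segment_plus_parallel[of 1 0 x y \<zeta>] by simp
    finally show ?thesis using u edge_vectors_iff[OF polytope_P] by blast
  qed
  then show ?thesis using z by blast
qed

text \<open>The edge that zonality provides in \<open>P\<close> is a translate of an edge of
  \<open>Q\<close>, because its exposing direction cannot be orthogonal to \<open>z\<close>:
  otherwise the edge, with vector \<open>y\<close>, would contain a translate of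
  \<open>[0, z]\<close>.\<close>

lemma zonal_Q: "zonal Q"
  unfolding zonal_def
proof (intro ballI allI impI)
  fix y u assume y: "y \<in> edge_vectors Q" and uy: "u \<bullet> y = 0"
  obtain w xw where w: "maxface Q w = closed_segment xw (xw + y)" "w \<bullet> z \<noteq> 0" "w \<bullet> y = 0" "y \<noteq> 0"
    using edge_vector_exposed[OF y] by metis
  obtain x where x: "closed_segment x (x + y) edge_of P" "closed_segment x (x + y) \<subseteq> maxface P u"
    using zonal_P y edge_vectors_Q uy unfolding zonal_def by blast
  then obtain u' where u': "closed_segment x (x + y) = maxface P u'"
    using polytope_face_eq_maxface[OF polytope_P] by (metis edge_of_def ends_in_segment(1) empty_iff)
  have "u' \<bullet> z \<noteq> 0"
  proof
    assume "u' \<bullet> z = 0"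
    then have eq: "closed_segment x (x + y) = maxface Q u' + closed_segment 0 z"
      using u' maxface_P maxface_segment_orthogonal by metis
    obtain q where "q \<in> maxface Q u'"
      using maxface_nonempty[OF polytope_imp_compact[OF polytope_Q] Q_nonempty] by blast
    then have mem: "q + 0 \<in> closed_segment x (x + y)" "q + z \<in> closed_segment x (x + y)"
      unfolding eq by (rule set_plus_intro, simp)+
    \<comment> \<open>\<open>w\<close> is constant along \<open>y\<close> but not along
      \<open>z\<close>, so no segment in direction \<open>y\<close> contains a translate of
      \<open>[0, z]\<close>.\<close>
    have const: "w \<bullet> v = w \<bullet> x" if "v \<in> closed_segment x (x + y)" for v
      using that w(3) by (auto simp: in_segment inner_add_right algebra_simps)
    show False using w(2) const[OF mem(1)] const[OF mem(2)] by (simp add: inner_add_right)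
  qed
  then obtain \<zeta> where z: "\<zeta> \<in> closed_segment 0 z" "maxface (closed_segment 0 z) u' = {\<zeta>}"
    using maxface_segment by metis
  have "maxface Q u' = closed_segment x (x + y) + {- \<zeta>}"
    unfolding u' maxface_P z(2) by (force simp: set_plus_def)
  also have "\<dots> = closed_segment (x - \<zeta>) (x - \<zeta> + y)"
    using closed_segment_plus_parallel[of 1 0 x y "- \<zeta>"] by simp
  finally have Qu': "maxface Q u' = closed_segment (x - \<zeta>) (x - \<zeta> + y)" .
  have "closed_segment (x - \<zeta>) (x - \<zeta> + y) edge_of Q"
    using maxface_face_of[OF polytope_imp_convex[OF polytope_Q], of u'] w(4)
    unfolding Qu' segment_edge_of_iff by auto
  \<comment> \<open>Adding \<open>\<zeta>\<close> maps \<open>Q\<close> into \<open>P\<close>, so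
    maximality of the shifted point in \<open>P\<close> gives maximality in
    \<open>Q\<close>.\<close>
  moreover have "maxface Q u' \<subseteq> maxface Q u"
  proof
    fix p assume p: "p \<in> maxface Q u'"
    then have "p + \<zeta> \<in> maxface P u"
      using x(2) unfolding u' maxface_P[of u'] z(2) by (auto intro: set_plus_intro)
    moreover have "q + \<zeta> \<in> P" if "q \<in> Q" for q
      using that z(1) P_eq by (auto intro: set_plus_intro)
    ultimately show "p \<in> maxface Q u"
      using p by (fastforce simp: maxface_def inner_add_right)
  qed
  ultimately show "\<exists>x. closed_segment x (x + y) edge_of Q \<and> closed_segment x (x + y) \<subseteq> maxface Q u"
    using Qu' by auto
qed

end

section \<open>Induction on the number of edge vectors\<close>

lemma polytope_edge_exists:
  fixes P :: "'a::euclidean_space set"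
  assumes "polytope P" "aff_dim P \<ge> 1"
  shows "\<exists>e. e edge_of P"
  using assms
proof (induction "nat (aff_dim P)" arbitrary: P rule: less_induct)
  case less
  show ?case
  proof (cases "aff_dim P = 1")
    case True
    then show ?thesis using less polytope_imp_convex face_of_refl unfolding edge_of_def by blast
  next
    case False
    obtain F where F: "F facet_of P" using polytope_facet_exists[of P] less by auto
    then have "aff_dim F = aff_dim P - 1" "F face_of P" by (auto simp: facet_of_def)
    moreover have "polytope F" using calculation less face_of_polytope_polytope by blast
    ultimately obtain e where "e edge_of F" using less False by force
    then show ?thesis using \<open>F face_of P\<close> face_of_trans unfolding edge_of_def by blast
  qed
qed

lemma zonotope_plus_segment:
  fixes Q :: "'a::euclidean_space set"
  assumes "zonotope Q"
  shows "zonotope (Q + closed_segment 0 z)"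
proof -
  obtain t zs where Q: "Q = (+) t ` (\<Sum>z\<leftarrow>zs. closed_segment (- z) z)"
    using assms by (auto simp: zonotope_def)
  define y where "y = (1 / 2) *\<^sub>R z"
  have trans: "(+) s ` A = {s} + A" for s and A :: "'a set" by (auto simp: set_plus_def)
  have seg: "closed_segment 0 z = {y} + closed_segment (- y) y"
    unfolding trans[symmetric] closed_segment_translation[symmetric] y_def
    by (simp flip: scaleR_add_left)
  have "Q + closed_segment 0 z = (+) (t + y) ` (\<Sum>z\<leftarrow>y # zs. closed_segment (- z) z)"
  proof -
    have "{t + y} = {t} + {y}" by (simp add: set_plus_def)
    then show ?thesis using seg unfolding Q trans by (simp add: ac_simps)
  qed
  then show ?thesis unfolding zonotope_def by blast
qed

theorem zonal_imp_zonotope: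
  fixes P :: "'a::euclidean_space set"
  assumes "polytope P" "P \<noteq> {}" "zonal P"
  shows "zonotope P"
  using assms
proof (induction "card (edge_vectors P)" arbitrary: P rule: less_induct)
  case less
  show ?case
  proof (cases "edge_vectors P = {}")
    case True
    have "\<not> aff_dim P \<ge> 1"
    proof
      assume "aff_dim P \<ge> 1"
      then obtain e where e: "e edge_of P" using polytope_edge_exists less by blast
      then obtain a b where "e = closed_segment a b" using polytope_edge_segment less by metis
      then have "b - a \<in> edge_vectors P" using e by (auto simp: edge_vectors_def intro!: exI[of _ a])
      then show False using True by blast
    qed
    then have "aff_dim P = 0"
      using \<open>P \<noteq> {}\<close> by (metis aff_dim_geq aff_dim_empty antisym_conv linorder_not_le zless_imp_add1_zle add.commute add.left_neutral order.order_iff_strict uminus_add_conv_diff diff_self)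
    then obtain p where "P = {p}" using aff_dim_eq_0 by blast
    then have "P = (+) p ` (\<Sum>z\<leftarrow>[]. closed_segment (- z) z)" by simp
    then show ?thesis unfolding zonotope_def by blast
  next
    case False
    then obtain z where z: "z \<in> edge_vectors P" by blast
    obtain Q where Q: "polytope Q" "Q \<noteq> {}" "P = Q + closed_segment 0 z"
      using zonal_summand less z by metis
    interpret peeled P Q z using Q less z by unfold_locales auto
    have "card (edge_vectors Q) < card (edge_vectors P)"
      using edge_vectors_Q finite_edge_vectors[OF polytope_P] psubset_card_mono by blast
    then have "zonotope Q" using less Q zonal_Q by blast
    then show ?thesis using zonotope_plus_segment Q by metis
  qed
qed

section \<open>From two-dimensional faces to the polytope\<close>

text \<open>The linear space parallel to the affine hull. A direction acts on \<open>P\<close> only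
  through its component in this space, and there only the zero vector is constant on
  \<open>P\<close>, so nonzero members expose proper faces.\<close>

definition directions :: "'a::euclidean_space set \<Rightarrow> 'a set" where
  "directions P = span {x - y |x y. x \<in> P \<and> y \<in> P}"

lemma subspace_directions: "subspace (directions P)"
  by (simp add: directions_def)

lemma diff_in_directions: "x \<in> P \<Longrightarrow> y \<in> P \<Longrightarrow> x - y \<in> directions P"
  by (auto simp: directions_def intro: span_base)

lemma directions_orthogonalI:
  assumes "\<And>x y. x \<in> P \<Longrightarrow> y \<in> P \<Longrightarrow> u \<bullet> (x - y) = 0" "w \<in> directions P"
  shows "u \<bullet> w = 0"
proof -
  have "w \<in> span {x - y |x y. x \<in> P \<and> y \<in> P}" using assms by (simp add: directions_def)
  then show ?thesis
    by (induction rule: span_induct_alt) (use assms in \<open>auto simp: inner_add_right\<close>)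
qed

lemma dim_directions:
  assumes "P \<noteq> {}"
  shows "int (dim (directions P)) = aff_dim P"
proof -
  obtain p where p: "p \<in> P" using assms by blast
  have "directions P = span ((+) (- p) ` P)"
  proof
    have "x - y \<in> span ((+) (- p) ` P)" if "x \<in> P" "y \<in> P" for x y
    proof -
      have "(- p + x) - (- p + y) \<in> span ((+) (- p) ` P)"
        using that by (intro span_diff span_base) auto
      then show ?thesis by simp
    qed
    then show "directions P \<subseteq> span ((+) (- p) ` P)"
      unfolding directions_def by (intro span_minimal) auto
    show "span ((+) (- p) ` P) \<subseteq> directions P"
      using diff_in_directions[OF _ p] by (intro span_minimal subspace_directions) auto
  qed
  then show ?thesis
    using aff_dim_eq_dim[of p P] p hull_inc[of p P affine] by simp
qed

lemma directions_component:
  obtains v where "v \<in> directions P" "\<And>w. w \<in> directions P \<Longrightarrow> u \<bullet> w = v \<bullet> w"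
proof -
  obtain v y where v: "v \<in> span (directions P)" "\<And>w. w \<in> span (directions P) \<Longrightarrow> orthogonal y w"
      "u = v + y"
    using orthogonal_subspace_decomp_exists[of "directions P" u] by metis
  then show thesis using that[of v] subspace_directions[of P]
    by (auto simp: orthogonal_def inner_add_left span_eq_iff[THEN iffD2])
qed

lemma maxface_cong_directions:
  assumes "\<And>w. w \<in> directions P \<Longrightarrow> u \<bullet> w = v \<bullet> w"
  shows "maxface P u = maxface P v"
proof -
  have "u \<bullet> y \<le> u \<bullet> x \<longleftrightarrow> v \<bullet> y \<le> v \<bullet> x" if "x \<in> P" "y \<in> P" for x y
    using assms[OF diff_in_directions[OF that]] unfolding inner_diff_right by linarith
  then show ?thesis by (auto simp: maxface_def)
qed

lemma maxface_eq_imp_zero: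
  assumes "v \<in> directions P" "maxface P v = P"
  shows "v = 0"
proof -
  have "v \<bullet> (x - y) = 0" if "x \<in> P" "y \<in> P" for x y
    using inner_maxface_eq[of x P v y] that assms(2) by (simp add: inner_diff_right)
  then have "v \<bullet> v = 0" using assms(1) by (rule directions_orthogonalI)
  then show ?thesis by simp
qed

text \<open>Being a good direction is a closed condition because finitely many edges can witness it.
  It is open because the face in a nonzero direction is proper, hence zonal by induction, and nearby
  directions expose faces of that face.\<close>

theorem zonal_if_2_faces_zonal:
  fixes P :: "'a::euclidean_space set"
  assumes "polytope P" "\<And>G. G face_of P \<Longrightarrow> aff_dim G = 2 \<Longrightarrow> zonal G"
  shows "zonal P"
  using assms
proof (induction "nat (aff_dim P)" arbitrary: P rule: less_induct)
  case less
  note P = \<open>polytope P\<close>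
  have convP: "convex P" using P polytope_imp_convex by blast
  show ?case
  proof (cases "aff_dim P = 2")
    case True
    then show ?thesis using less convP face_of_refl by blast
  next
    case not2: False
    show ?thesis unfolding zonal_def
    proof (intro ballI allI impI)
      fix z u assume z: "z \<in> edge_vectors P" and uz: "u \<bullet> z = 0"
      obtain x0 where e0: "closed_segment x0 (x0 + z) edge_of P"
        using z by (auto simp: edge_vectors_def)
      then have z0: "z \<noteq> 0" by (auto simp: segment_edge_of_iff)
      have sub0: "closed_segment x0 (x0 + z) \<subseteq> P" using e0 edge_of_imp_subset by blast
      then have Pne: "P \<noteq> {}" by auto
      have zL: "z \<in> directions P" using diff_in_directions[of "x0 + z" P x0] sub0 by auto
      define good where "good v \<longleftrightarrow>
        (\<exists>x. closed_segment x (x + z) edge_of P \<and> closed_segment x (x + z) \<subseteq> maxface P v)" for v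
      define S where "S = {v \<in> directions P. v \<bullet> z = 0}"
      have S_eq: "S = {v \<in> directions P. \<forall>x\<in>span {z}. orthogonal x v}"
        by (auto simp: S_def orthogonal_def span_singleton inner_commute)
      have subS: "subspace S"
        using subspace_directions[of P] unfolding S_def subspace_def by (auto simp: inner_add_left)
      have "dim S + dim (span {z}) = dim (directions P)" unfolding S_eq
        using zL subspace_directions
        by (intro dim_subspace_orthogonal_to_vectors subspace_span) (auto intro: span_minimal[THEN subsetD])
      \<comment> \<open>\<open>S\<close> is a line exactly when \<open>P\<close> is a polygon, a
        case already settled by the hypothesis; in every other dimension the origin can be removed
        without disconnecting \<open>S\<close>.\<close>
      then have "dim S \<noteq> 1" using not2 dim_directions[OF Pne] z0 by (simp add: dim_singleton)
      then have conn: "connected (S - {0})"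
        using subS subspace_imp_convex by (intro connected_punctured_convex) (auto simp: aff_dim_subspace)
      define A where "A = {v \<in> S - {0}. good v}"
      have "closedin (top_of_set (S - {0})) A"
      proof -
        define E where "E = {e. e edge_of P \<and> (\<exists>x. e = closed_segment x (x + z))}"
        have "finite E"
          using finite_subset[OF _ finite_polytope_faces[OF P], of E] by (auto simp: E_def edge_of_def)
        moreover have "closed {v. e \<subseteq> maxface P v}" if "e \<in> E" for e
        proof -
          have "{v. e \<subseteq> maxface P v} = (\<Inter>x\<in>e. \<Inter>y\<in>P. {v. v \<bullet> y \<le> v \<bullet> x})"
            using that by (auto simp: E_def maxface_def dest: edge_of_imp_subset)
          then show ?thesis
            by (auto intro!: closed_INT closed_Collect_le continuous_intros)
        qed
        ultimately have "closed (\<Union>e\<in>E. {v. e \<subseteq> maxface P v})" by (intro closed_UN) auto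
        moreover have "A = (S - {0}) \<inter> (\<Union>e\<in>E. {v. e \<subseteq> maxface P v})"
          by (auto simp: A_def good_def E_def)
        ultimately show ?thesis by (auto simp: closedin_closed)
      qed
      moreover have "openin (top_of_set (S - {0})) A"
      proof (subst openin_subopen, intro ballI)
        fix v assume v: "v \<in> A"
        define F where "F = maxface P v"
        have F: "F face_of P" unfolding F_def using convP maxface_face_of by blast
        have "F \<noteq> P" using v maxface_eq_imp_zero[of v P] by (auto simp: A_def S_def F_def)
        then have "aff_dim F < aff_dim P" using face_of_aff_dim_lt[OF convP F] by blast
        moreover obtain x where x: "closed_segment x (x + z) edge_of P" "closed_segment x (x + z) \<subseteq> F"
          using v by (auto simp: A_def good_def F_def)
        then have "F \<noteq> {}" by auto
        from dim_directions[OF this] have "0 \<le> aff_dim F" by linarith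
        moreover have polyF: "polytope F" using F P face_of_polytope_polytope by blast
        ultimately have zonF: "zonal F"
          using less.hyps[of F] less.prems(2) F face_of_trans by (metis zless_nat_conj order.strict_trans1)
        have "closed_segment x (x + z) edge_of F"
          using x F face_of_face unfolding edge_of_def by blast
        then have zF: "z \<in> edge_vectors F" by (auto simp: edge_vectors_def)
        obtain W where W: "open W" "v \<in> W" "\<And>v'. v' \<in> W \<Longrightarrow> maxface P v' \<subseteq> F"
          using maxface_upper_semicontinuous[OF P, of v] unfolding F_def by metis
        have "good v'" if v': "v' \<in> W" "v' \<in> S" for v'
        proof -
          have "v' \<bullet> z = 0" using v' by (auto simp: S_def)
          then obtain y where y: "closed_segment y (y + z) edge_of F"
              "closed_segment y (y + z) \<subseteq> maxface F v'"
            using zonF zF unfolding zonal_def by blast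
          have "maxface F v' = maxface P v'" unfolding F_def
            using W(3)[OF v'(1)] maxface_nonempty[OF polytope_imp_compact[OF P] Pne]
            by (intro maxface_maxface) (auto simp: F_def)
          moreover have "closed_segment y (y + z) edge_of P"
            using y(1) F face_of_trans unfolding edge_of_def by blast
          ultimately show ?thesis using y unfolding good_def by auto
        qed
        then show "\<exists>T. openin (top_of_set (S - {0})) T \<and> v \<in> T \<and> T \<subseteq> A"
          using W v by (intro exI[of _ "(S - {0}) \<inter> W"]) (auto simp: A_def)
      qed
      ultimately have A: "A = {} \<or> A = S - {0}" using conn connected_clopen by blast
      obtain u' where u': "u' \<in> directions P" "\<And>w. w \<in> directions P \<Longrightarrow> u \<bullet> w = u' \<bullet> w"
        using directions_component by metis
      have uu': "maxface P u = maxface P u'" by (rule maxface_cong_directions[OF u'(2)])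
      obtain u0 where u0: "closed_segment x0 (x0 + z) = maxface P u0"
        using polytope_face_eq_maxface[OF P] e0 by (metis edge_of_def ends_in_segment(1) empty_iff)
      obtain u0' where u0': "u0' \<in> directions P" "\<And>w. w \<in> directions P \<Longrightarrow> u0 \<bullet> w = u0' \<bullet> w"
        using directions_component by metis
      have uu0': "maxface P u0 = maxface P u0'" by (rule maxface_cong_directions[OF u0'(2)])
      have "u0 \<bullet> z = 0" using inner_edge_vector_eq_0[of x0 z P u0] u0 by simp
      have "good u'"
      proof (cases "u' = 0 \<or> u0' = 0")
        \<comment> \<open>\<open>u' = 0\<close> means that \<open>u\<close> is constant on
          \<open>P\<close>; \<open>u0' = 0\<close> means that \<open>P\<close> is the edge itself,
          on which \<open>u\<close> is constant as well.\<close>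
        case True
        then have "maxface P u' = P"
        proof
          assume "u' = 0"
          then show ?thesis by (auto simp: maxface_def)
        next
          assume "u0' = 0"
          then have "P = closed_segment x0 (x0 + z)" using u0 uu0' by (auto simp: maxface_def)
          then have "u \<bullet> w = u \<bullet> x0" if "w \<in> P" for w
            using that uz by (auto simp: in_segment inner_add_right algebra_simps)
          from maxface_eq_self[OF this] show ?thesis using uu' by simp
        qed
        then show ?thesis using e0 sub0 by (auto simp: good_def)
      next
        case False
        have "u' \<in> S - {0}" "u0' \<in> S - {0}"
          using False u' u0' uz \<open>u0 \<bullet> z = 0\<close> zL by (auto simp: S_def)
        \<comment> \<open>The given edge shows that \<open>A\<close> is not empty, which leaves only
          \<open>A = S - {0}\<close>.\<close>
        moreover have "good u0'" using e0 u0 uu0' unfolding good_def by (metis order_refl)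
        ultimately have "u' \<in> A" using A by (auto simp: A_def)
        then show ?thesis by (simp add: A_def)
      qed
      then show "\<exists>x. closed_segment x (x + z) edge_of P \<and> closed_segment x (x + z) \<subseteq> maxface P u"
        by (simp add: good_def uu')
    qed
  qed
qed

section \<open>Inscribed polygons\<close>

text \<open>An edge is written by its midpoint \<open>w\<close> and half its edge vector
  \<open>z\<close>: the bisector becomes \<open>z \<bullet> (x - w) = 0\<close>, reflection in a
  point only moves \<open>w\<close>, and the length is \<open>2 * norm z\<close>.\<close>

abbreviation csegment :: "'a::euclidean_space \<Rightarrow> 'a \<Rightarrow> 'a set" where
  "csegment w z \<equiv> closed_segment (w - z) (w + z)"

lemma in_csegment_iff: "x \<in> csegment w z \<longleftrightarrow> (\<exists>t. \<bar>t\<bar> \<le> 1 \<and> x = w + t *\<^sub>R z)"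
proof
  assume "x \<in> csegment w z"
  then obtain s where s: "0 \<le> s" "s \<le> 1" "x = (1 - s) *\<^sub>R (w - z) + s *\<^sub>R (w + z)"
    by (auto simp: in_segment)
  then have "x = w + (2 * s - 1) *\<^sub>R z" by (simp add: algebra_simps flip: scaleR_add_left)
  then show "\<exists>t. \<bar>t\<bar> \<le> 1 \<and> x = w + t *\<^sub>R z" using s by (intro exI[of _ "2 * s - 1"]) auto
next
  assume "\<exists>t. \<bar>t\<bar> \<le> 1 \<and> x = w + t *\<^sub>R z"
  then obtain t where t: "\<bar>t\<bar> \<le> 1" "x = w + t *\<^sub>R z" by blast
  have "(1 - (1 + t) / 2) *\<^sub>R (w - z) + ((1 + t) / 2) *\<^sub>R (w + z)
      = ((1 - (1 + t) / 2) + (1 + t) / 2) *\<^sub>R w + ((1 + t) / 2 - (1 - (1 + t) / 2)) *\<^sub>R z"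
    by (simp only: scaleR_add_left scaleR_diff_left scaleR_add_right scaleR_diff_right) simp
  also have "\<dots> = x" using t by (simp add: field_simps)
  finally show "x \<in> csegment w z"
    using t unfolding in_segment by (intro exI[of _ "(1 + t) / 2"]) auto
qed

lemma csegment_ends_distinct:
  fixes z :: "'a::real_vector"
  assumes "z \<noteq> 0"
  shows "w - z \<noteq> w + z"
proof
  assume "w - z = w + z"
  moreover have "(w + z) - (w - z) = 2 *\<^sub>R z" by (simp add: scaleR_2)
  ultimately have "2 *\<^sub>R z = 0" by (metis diff_self)
  then show False using assms by simp
qed

lemma csegment_rel_interior:
  assumes "\<bar>t\<bar> < 1" "z \<noteq> 0"
  shows "w + t *\<^sub>R z \<in> rel_interior (csegment w z)"
proof -
  have "w - z \<noteq> w + z" using csegment_ends_distinct assms(2) by blast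
  moreover have "w + t *\<^sub>R z \<in> csegment w z" using assms unfolding in_csegment_iff by force
  moreover have "w + t *\<^sub>R z \<noteq> w + z" "w + t *\<^sub>R z \<noteq> w - z"
  proof -
    have "t *\<^sub>R z \<noteq> 1 *\<^sub>R z" using assms unfolding scaleR_cancel_right by auto
    then show "w + t *\<^sub>R z \<noteq> w + z" by simp
    have "t *\<^sub>R z \<noteq> (-1) *\<^sub>R z" using assms unfolding scaleR_cancel_right by auto
    then show "w + t *\<^sub>R z \<noteq> w - z"
      by (metis add_left_cancel diff_conv_add_uminus scaleR_minus1_left)
  qed
  ultimately show ?thesis by (auto simp: rel_interior_closed_segment open_segment_def)
qed

lemma csegment_reflect: "(\<lambda>x. 2 *\<^sub>R m - x) ` csegment w z = csegment (2 *\<^sub>R m - w) z"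
proof -
  have "x \<in> (\<lambda>x. 2 *\<^sub>R m - x) ` csegment w z \<longleftrightarrow> 2 *\<^sub>R m - x \<in> csegment w z" for x
    by (force simp: image_iff)
  moreover have "2 *\<^sub>R m - x \<in> csegment w z \<longleftrightarrow> x \<in> csegment (2 *\<^sub>R m - w) z" for x
    unfolding in_csegment_iff
  proof safe
    fix t :: real assume t: "\<bar>t\<bar> \<le> 1" "2 *\<^sub>R m - x = w + t *\<^sub>R z"
    then have "x = 2 *\<^sub>R m - w + (- t) *\<^sub>R z" by (simp add: algebra_simps)
    then show "\<exists>t. \<bar>t\<bar> \<le> 1 \<and> x = 2 *\<^sub>R m - w + t *\<^sub>R z" using t by (intro exI[of _ "- t"]) auto
  next
    fix t :: real assume t: "\<bar>t\<bar> \<le> 1"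
    have "2 *\<^sub>R m - (2 *\<^sub>R m - w + t *\<^sub>R z) = w + (- t) *\<^sub>R z" by (simp add: algebra_simps)
    then show "\<exists>s. \<bar>s\<bar> \<le> 1 \<and> 2 *\<^sub>R m - (2 *\<^sub>R m - w + t *\<^sub>R z) = w + s *\<^sub>R z"
      using t by (intro exI[of _ "- t"]) auto
  qed
  ultimately show ?thesis by blast
qed

lemma segment_eq_csegment:
  "closed_segment a b = csegment ((1/2) *\<^sub>R (a + b)) ((1/2) *\<^sub>R (b - a))"
proof -
  have "(1/2) *\<^sub>R (a + b) - (1/2) *\<^sub>R (b - a) = a" "(1/2) *\<^sub>R (a + b) + (1/2) *\<^sub>R (b - a) = b"
    by (simp_all add: algebra_simps flip: scaleR_add_left)
  then show ?thesis by simp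
qed

text \<open>Expand both squared distances: their difference shows that the bisector of a chord
  passes through the center, their sum is Pythagoras.\<close>

lemma csegment_center_orthogonal:
  assumes "norm (w - z - m) = r" "norm (w + z - m) = r"
  shows "z \<bullet> (w - m) = 0" "(norm (w - m))\<^sup>2 + (norm z)\<^sup>2 = r\<^sup>2"
proof -
  have "((w - m) - z) \<bullet> ((w - m) - z) = r\<^sup>2" "((w - m) + z) \<bullet> ((w - m) + z) = r\<^sup>2"
    using assms by (auto simp: algebra_simps simp flip: power2_norm_eq_inner)
  then show "z \<bullet> (w - m) = 0" "(norm (w - m))\<^sup>2 + (norm z)\<^sup>2 = r\<^sup>2"
    unfolding power2_norm_eq_inner inner_diff_left inner_diff_right inner_add_left inner_add_right
    by (simp_all add: inner_commute)
qed

lemma csegment_edge_nonzero: "csegment w z edge_of P \<Longrightarrow> z \<noteq> 0"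
  by (auto simp: segment_edge_of_iff)

lemma affine_hull_diff_in_directions:
  assumes "x \<in> affine hull P" "y \<in> affine hull P"
  shows "x - y \<in> directions P"
proof -
  have "P \<noteq> {}" using assms by auto
  then obtain p where p: "p \<in> P" by blast
  have "affine ((+) p ` directions P)"
    using subspace_directions subspace_imp_affine affine_translation by blast
  moreover have "x \<in> (+) p ` directions P" if "x \<in> P" for x
    using diff_in_directions[OF that p] by (intro image_eqI[of _ _ "x - p"]) auto
  then have "P \<subseteq> (+) p ` directions P" by blast
  ultimately have "affine hull P \<subseteq> (+) p ` directions P" by (intro hull_minimal)
  then obtain v w where "v \<in> directions P" "w \<in> directions P" "x = p + v" "y = p + w"
    using assms by blast
  then show ?thesis using subspace_diff[OF subspace_directions] by simp
qed

text \<open>In an irredundant description of \<open>P\<close> by halfspaces within its affine hull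
  some halfspace excludes \<open>x\<close>, and irredundancy makes its boundary cut out a
  facet.\<close>

lemma polytope_facet_separates:
  assumes P: "polytope P" and x: "x \<in> affine hull P" "x \<notin> P"
  obtains u where "maxface P u facet_of P" "\<And>y. y \<in> maxface P u \<Longrightarrow> u \<bullet> y < u \<bullet> x"
proof -
  obtain F where F: "finite F" "P = affine hull P \<inter> \<Inter>F"
      "\<forall>h\<in>F. \<exists>a b. a \<noteq> 0 \<and> h = {x. a \<bullet> x \<le> b}" "\<forall>F'. F' \<subset> F \<longrightarrow> P \<subset> affine hull P \<inter> \<Inter>F'"
    using polytope_imp_polyhedron[OF P] unfolding polyhedron_Int_affine_minimal by auto
  then obtain a b where ab: "\<And>h. h \<in> F \<Longrightarrow> a h \<noteq> 0 \<and> h = {x. a h \<bullet> x \<le> b h}" by metis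
  obtain h where h: "h \<in> F" "x \<notin> h" using F(2) x by blast
  have facet: "P \<inter> {x. a h \<bullet> x = b h} facet_of P"
    using facet_of_polyhedron_explicit[OF F(1,2) ab] F(4) h by blast
  then obtain y where y: "y \<in> P" "a h \<bullet> y = b h" by (auto simp: facet_of_def)
  have le: "a h \<bullet> y \<le> b h" if "y \<in> P" for y using that ab[OF h(1)] F(2) h(1) by blast
  have eq: "P \<inter> {x. a h \<bullet> x = b h} = maxface P (a h)"
    using y le by (force simp: maxface_def)
  show thesis
  proof (rule that)
    show "maxface P (a h) facet_of P" using facet eq by simp
    fix y assume "y \<in> maxface P (a h)"
    then have "a h \<bullet> y = b h" unfolding eq[symmetric] by simp
    moreover have "x \<notin> {x. a h \<bullet> x \<le> b h}" using h ab[OF h(1)] by metis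
    ultimately show "a h \<bullet> y < a h \<bullet> x" by simp
  qed
qed

lemma maxface_scaleR: "c > 0 \<Longrightarrow> maxface P (c *\<^sub>R u) = maxface P u"
  by (simp add: maxface_def)

locale inscribed_polygon =
  fixes G :: "'a::euclidean_space set" and m r
  assumes polytope_G: "polytope G" and aff_dim_G: "aff_dim G = 2"
    and m: "m \<in> affine hull G" and extreme: "\<And>v. v extreme_point_of G \<Longrightarrow> norm (v - m) = r"
begin

lemma convex_G: "convex G"
  by (rule polytope_imp_convex[OF polytope_G])

lemma G_nonempty: "G \<noteq> {}"
  using aff_dim_G by auto

text \<open>A nonzero remainder would be a third pairwise orthogonal vector in a two-dimensional
  space.\<close>

lemma orthogonal_expansion:
  assumes "u \<in> directions G" "norm u = 1" "z \<in> directions G" "z \<noteq> 0" "u \<bullet> z = 0" "v \<in> directions G"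
  shows "v = (u \<bullet> v) *\<^sub>R u + ((z \<bullet> v) / (z \<bullet> z)) *\<^sub>R z"
proof (rule ccontr)
  assume neq: "\<not> ?thesis"
  define y where "y = v - ((u \<bullet> v) *\<^sub>R u + ((z \<bullet> v) / (z \<bullet> z)) *\<^sub>R z)"
  have y0: "y \<noteq> 0" using neq by (auto simp: y_def)
  have uu: "u \<bullet> u = 1" using assms by (simp add: norm_eq_1)
  have yu: "y \<bullet> u = 0" "y \<bullet> z = 0"
    using assms uu by (auto simp: y_def inner_diff_left inner_add_left inner_diff_right inner_add_right inner_commute)
  have "y \<in> directions G" unfolding y_def
    using assms subspace_directions by (intro subspace_diff subspace_add subspace_scale)
  then have "{u, z, y} \<subseteq> directions G" using assms by blast
  moreover have "pairwise orthogonal {u, z, y}"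
    using yu assms by (auto simp: pairwise_def orthogonal_def inner_commute)
  then have "independent {u, z, y}"
    using pairwise_orthogonal_independent y0 assms by fastforce
  ultimately have "card {u, z, y} \<le> dim (directions G)" by (rule independent_card_le_dim)
  moreover have "card {u, z, y} = 3"
  proof -
    have "u \<noteq> z" "u \<noteq> y" "z \<noteq> y" using yu uu assms y0 by auto
    then show ?thesis by simp
  qed
  ultimately show False using dim_directions[OF G_nonempty] aff_dim_G by simp
qed

lemma norm_expansion:
  assumes "u \<in> directions G" "norm u = 1" "z \<in> directions G" "z \<noteq> 0" "u \<bullet> z = 0" "x \<in> affine hull G"
  shows "(norm (x - m))\<^sup>2 = (u \<bullet> (x - m))\<^sup>2 + (z \<bullet> (x - m))\<^sup>2 / (z \<bullet> z)"
proof -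
  let ?v = "x - m"
  have "?v \<bullet> ?v = ?v \<bullet> ((u \<bullet> ?v) *\<^sub>R u + ((z \<bullet> ?v) / (z \<bullet> z)) *\<^sub>R z)"
    using orthogonal_expansion[OF assms(1-5) affine_hull_diff_in_directions[OF assms(6) m]]
    by (rule arg_cong[where f = "\<lambda>w. ?v \<bullet> w"])
  then show ?thesis
    unfolding power2_norm_eq_inner by (simp add: inner_add_right power2_eq_square inner_commute)
qed

lemma edge_orthogonal:
  assumes "csegment w z edge_of G"
  shows "z \<bullet> (w - m) = 0" "(norm (w - m))\<^sup>2 + (norm z)\<^sup>2 = r\<^sup>2"
proof -
  have "norm (w - z - m) = r" "norm (w + z - m) = r"
    using edge_endpoints_extreme[OF assms] extreme by auto
  then show "z \<bullet> (w - m) = 0" "(norm (w - m))\<^sup>2 + (norm z)\<^sup>2 = r\<^sup>2"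
    using csegment_center_orthogonal by blast+
qed

lemma edge_in_directions:
  assumes "csegment w z edge_of G"
  shows "z \<in> directions G"
proof -
  have "(w + z) - (w - z) \<in> directions G"
    using edge_of_imp_subset[OF assms] by (intro diff_in_directions) auto
  then have "(1/2) *\<^sub>R ((w + z) - (w - z)) \<in> directions G"
    using subspace_directions subspace_scale by blast
  then show ?thesis by (simp add: algebra_simps flip: scaleR_add_left)
qed

lemma edge_center_in: "csegment w z edge_of G \<Longrightarrow> w \<in> G"
  using edge_of_imp_subset[of "csegment w z" G] in_csegment_iff[of w w z] by force

text \<open>\<open>u\<close> is the unit outer normal of the edge within the plane of
  \<open>G\<close>, and the midpoint lies on the line through \<open>m\<close> in direction
  \<open>u\<close>. The sign of \<open>\<beta>\<close> is open, since the center may lie beyond the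
  edge. The factor \<open>c\<close> links \<open>u\<close> to a given exposing functional
  \<open>u0\<close>.\<close>

lemma edge_frame:
  assumes e: "csegment w z edge_of G" and u0: "csegment w z = maxface G u0"
  obtains u c \<beta> where "u \<in> directions G" "norm u = 1" "u \<bullet> z = 0" "maxface G u = csegment w z"
    "w = m + \<beta> *\<^sub>R u" "c > 0" "\<And>v. v \<in> directions G \<Longrightarrow> u0 \<bullet> v = c * (u \<bullet> v)"
proof -
  obtain u1 where u1: "u1 \<in> directions G" "\<And>v. v \<in> directions G \<Longrightarrow> u0 \<bullet> v = u1 \<bullet> v"
    using directions_component by metis
  have max1: "maxface G u1 = csegment w z" using maxface_cong_directions[OF u1(2)] u0 by simp
  have "u1 \<noteq> 0"
  proof
    assume "u1 = 0"
    then have "G = csegment w z" using max1 by (auto simp: maxface_def)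
    then show False using e aff_dim_G by (auto simp: edge_of_def)
  qed
  define u where "u = (1 / norm u1) *\<^sub>R u1"
  have u: "u \<in> directions G" "norm u = 1" "u1 = norm u1 *\<^sub>R u"
    using u1(1) subspace_scale[OF subspace_directions] \<open>u1 \<noteq> 0\<close> by (auto simp: u_def)
  have maxu: "maxface G u = csegment w z" using max1 \<open>u1 \<noteq> 0\<close> by (simp add: u_def maxface_scaleR)
  have "w - z \<in> maxface G u" "w + z \<in> maxface G u" unfolding maxu by auto
  from inner_maxface_eq[OF this] have uz: "u \<bullet> z = 0" by (simp add: inner_add_right inner_diff_right)
  have z: "z \<noteq> 0" "z \<in> directions G" "z \<bullet> (w - m) = 0"
    using csegment_edge_nonzero edge_in_directions edge_orthogonal e by auto
  have "w \<in> affine hull G" using edge_center_in[OF e] by (rule hull_inc)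
  then have "w - m \<in> directions G" using m affine_hull_diff_in_directions by blast
  from orthogonal_expansion[OF u(1,2) z(2,1) uz this]
  have "w = m + (u \<bullet> (w - m)) *\<^sub>R u" using z(3) by (simp add: algebra_simps)
  moreover have "norm u1 > 0" using \<open>u1 \<noteq> 0\<close> by simp
  moreover have "u0 \<bullet> v = norm u1 * (u \<bullet> v)" if "v \<in> directions G" for v
    using u1(2)[OF that] u(3) by (metis inner_scaleR_left)
  ultimately show thesis using that u(1,2) uz maxu by blast
qed

lemma edge_frame':
  assumes e: "csegment w z edge_of G"
  obtains u \<beta> where "u \<in> directions G" "norm u = 1" "u \<bullet> z = 0" "maxface G u = csegment w z"
    "w = m + \<beta> *\<^sub>R u"
proof -
  have "csegment w z face_of G" "csegment w z \<noteq> {}" using e by (auto simp: edge_of_def)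
  then obtain u0 where "csegment w z = maxface G u0" using polytope_face_eq_maxface[OF polytope_G] by metis
  then show thesis using edge_frame[OF e] that by metis
qed

lemma edge_point_below:
  assumes e: "csegment w z edge_of G" and u: "maxface G u = csegment w z"
  obtains p where "p \<in> G" "u \<bullet> p < u \<bullet> w"
proof -
  have "G \<noteq> csegment w z" using e aff_dim_G by (auto simp: edge_of_def)
  then obtain p where p: "p \<in> G" "p \<notin> maxface G u" using u edge_of_imp_subset[OF e] by blast
  moreover have "w \<in> maxface G u" unfolding u in_csegment_iff by force
  ultimately have "u \<bullet> p < u \<bullet> w" using maxface_memI by force
  then show thesis using that p by blast
qed

text \<open>In dimension two the only directions orthogonal to an edge are the two normals, and the
  reflected edge is exposed by the opposite one.\<close>

lemma zonal_if_edges_symmetric: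
  assumes sym: "\<And>w z. csegment w z edge_of G \<Longrightarrow> csegment (2 *\<^sub>R m - w) z edge_of G \<and> w \<noteq> m"
  shows "zonal G"
  unfolding zonal_def
proof (intro ballI allI impI)
  fix v u assume v: "v \<in> edge_vectors G" and uv: "u \<bullet> v = 0"
  then obtain x where x: "closed_segment x (x + v) edge_of G" by (auto simp: edge_vectors_def)
  define z where "z = (1/2) *\<^sub>R v"
  define w where "w = x + z"
  have v2: "v = z + z" by (simp add: z_def flip: scaleR_add_left)
  have seg: "closed_segment y (y + v) = csegment (y + z) z" for y by (simp add: v2 algebra_simps)
  have e: "csegment w z edge_of G" using x seg by (simp add: w_def)
  have uz: "u \<bullet> z = 0" using uv by (simp add: z_def)
  note z0 = csegment_edge_nonzero[OF e] and zL = edge_in_directions[OF e]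
  obtain u1 \<beta> where u1: "u1 \<in> directions G" "norm u1 = 1" "u1 \<bullet> z = 0" "maxface G u1 = csegment w z"
      "w = m + \<beta> *\<^sub>R u1"
    using edge_frame'[OF e] by metis
  obtain u' where u': "u' \<in> directions G" "\<And>y. y \<in> directions G \<Longrightarrow> u \<bullet> y = u' \<bullet> y"
    using directions_component by metis
  have max: "maxface G u = maxface G u'" using maxface_cong_directions[OF u'(2)] .
  define s where "s = u1 \<bullet> u'"
  have "z \<bullet> u' = 0" using u'(2)[OF zL] uz by (simp add: inner_commute)
  then have us: "u' = s *\<^sub>R u1" using orthogonal_expansion[OF u1(1,2) zL z0 u1(3) u'(1)] by (simp add: s_def)
  let ?w = "2 *\<^sub>R m - w"
  have e': "csegment ?w z edge_of G" "w \<noteq> m" using sym[OF e] by auto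
  obtain u2 \<beta>2 where u2: "u2 \<in> directions G" "norm u2 = 1" "u2 \<bullet> z = 0" "maxface G u2 = csegment ?w z"
      "?w = m + \<beta>2 *\<^sub>R u2"
    using edge_frame'[OF e'(1)] by metis
  define s2 where "s2 = u1 \<bullet> u2"
  have us2: "u2 = s2 *\<^sub>R u1"
    using orthogonal_expansion[OF u1(1,2) zL z0 u1(3) u2(1)] u2(3) by (simp add: s2_def inner_commute)
  \<comment> \<open>With equal outer normals the edge and its reflection would coincide, so both
    midpoints would lie on one line in direction \<open>z\<close>. This forces
    \<open>\<beta> = 0\<close>, that is \<open>w = m\<close>.\<close>
  have "\<not> s2 > 0"
  proof
    assume "s2 > 0"
    then have eq: "csegment ?w z = csegment w z" using u2 u1 us2 by (simp add: maxface_scaleR)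
    then have "?w \<in> csegment w z" unfolding eq[symmetric] in_csegment_iff by (intro exI[of _ 0]) auto
    then obtain t where t: "?w = w + t *\<^sub>R z" by (auto simp: in_csegment_iff)
    then have "2 *\<^sub>R (m - w) = t *\<^sub>R z" by (simp add: algebra_simps scaleR_2)
    then have "u1 \<bullet> (2 *\<^sub>R (m - w)) = 0" using u1(3) by simp
    then have "\<beta> = 0" using u1(2,5) by auto
    then show False using e'(2) u1(5) by simp
  qed
  moreover have "s2 \<noteq> 0" using us2 u2(2) by auto
  ultimately have "s2 < 0" by simp
  then have "maxface G ((- s2) *\<^sub>R (- u1)) = maxface G (- u1)" by (intro maxface_scaleR) auto
  then have neg: "maxface G (- u1) = csegment ?w z" using us2 u2(4) by simp
  \<comment> \<open>On the plane \<open>u\<close> acts as \<open>s\<close> times the normal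
    \<open>u1\<close>; the sign of \<open>s\<close> selects the reflected edge, the whole polygon or
    the edge itself.\<close>
  have "\<exists>y. csegment y z edge_of G \<and> csegment y z \<subseteq> maxface G u"
  proof (cases s "0::real" rule: linorder_cases)
    case less
    then have "maxface G ((- s) *\<^sub>R (- u1)) = maxface G (- u1)" by (intro maxface_scaleR) auto
    then have "maxface G u = csegment ?w z" using us max neg by simp
    then show ?thesis using e' by blast
  next
    case equal
    then have "maxface G u = G" using us max by (auto simp: maxface_def)
    then show ?thesis using e edge_of_imp_subset by blast
  next
    case greater
    then have "maxface G u = csegment w z" using us max u1(4) by (simp add: maxface_scaleR)
    then show ?thesis using e by blast
  qed
  then obtain y where "csegment (y - z + z) z edge_of G" "csegment (y - z + z) z \<subseteq> maxface G u" by auto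
  then show "\<exists>x. closed_segment x (x + v) edge_of G \<and> closed_segment x (x + v) \<subseteq> maxface G u"
    unfolding seg by blast
qed

section \<open>Polygons under the projection condition\<close>

lemma norm_le_r:
  assumes "x \<in> G"
  shows "norm (x - m) \<le> r"
proof -
  have "G \<subseteq> cball m r"
    using extreme
    by (intro polytope_subset_if_extreme[OF polytope_G]) (auto simp: dist_norm norm_minus_commute)
  then have "x \<in> cball m r" using assms by blast
  then show ?thesis by (simp add: dist_norm norm_minus_commute)
qed

text \<open>Balls are strictly convex: inner points of a chord lie strictly inside the ball that
  contains \<open>G\<close>.\<close>

lemma extreme_if_norm_eq:
  assumes "x \<in> G" "norm (x - m) = r"
  shows "x extreme_point_of G"
  unfolding extreme_point_of_def
proof (intro conjI ballI)
  fix a b assume ab: "a \<in> G" "b \<in> G"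
  show "x \<notin> open_segment a b"
    using dist_decreases_open_segment[of x a b m] norm_le_r[OF ab(1)] norm_le_r[OF ab(2)] assms
    by (auto simp: dist_norm norm_minus_commute)
qed (use assms in simp)

text \<open>A vertex lies on the circle, so a large component along the edge leaves a small one
  along the normal: \<open>G\<close> lies between the line of the edge and its reflection in
  \<open>m\<close>. As this holds for every edge, the reflection of a vertex violates no facet
  inequality, and \<open>G\<close> is centrally symmetric.\<close>

theorem zonal_if_slabs_avoid_vertices:
  assumes slab: "\<And>w z v. csegment w z edge_of G \<Longrightarrow> v extreme_point_of G \<Longrightarrow> z \<bullet> z \<le> \<bar>z \<bullet> (v - m)\<bar>"
  shows "zonal G"
proof -
  have frame: "\<beta> > 0 \<and> (\<forall>x\<in>G. \<bar>u \<bullet> (x - m)\<bar> \<le> \<beta>)"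
    if e: "csegment w z edge_of G" and u: "u \<in> directions G" "norm u = 1" "u \<bullet> z = 0"
      "maxface G u = csegment w z" "w = m + \<beta> *\<^sub>R u" for w z u \<beta>
  proof -
    note z0 = csegment_edge_nonzero[OF e] and zL = edge_in_directions[OF e]
    have r: "r\<^sup>2 = \<beta>\<^sup>2 + (norm z)\<^sup>2" using edge_orthogonal(2)[OF e] u by simp
    have "\<bar>u \<bullet> (v - m)\<bar> \<le> \<bar>\<beta>\<bar>" if v: "v extreme_point_of G" for v
    proof -
      have vG: "v \<in> G" using v by (simp add: extreme_point_of_def)
      have "r\<^sup>2 = (u \<bullet> (v - m))\<^sup>2 + (z \<bullet> (v - m))\<^sup>2 / (z \<bullet> z)"
        using norm_expansion[OF u(1,2) zL z0 u(3) hull_inc[OF vG]] extreme[OF v] by simp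
      moreover have "(z \<bullet> z)\<^sup>2 \<le> (z \<bullet> (v - m))\<^sup>2"
        using slab[OF e v] by (metis abs_le_square_iff abs_of_nonneg inner_ge_zero)
      then have "z \<bullet> z \<le> (z \<bullet> (v - m))\<^sup>2 / (z \<bullet> z)"
        using z0 by (simp add: pos_le_divide_eq power2_eq_square)
      ultimately have "(u \<bullet> (v - m))\<^sup>2 \<le> \<beta>\<^sup>2" using r by (simp add: power2_norm_eq_inner)
      then show ?thesis by (simp add: abs_le_square_iff)
    qed
    then have G: "G \<subseteq> {x. u \<bullet> x \<le> u \<bullet> m + \<bar>\<beta>\<bar>} \<inter> {x. u \<bullet> x \<ge> u \<bullet> m - \<bar>\<beta>\<bar>}"
      by (intro polytope_subset_if_extreme[OF polytope_G] convex_Int convex_halfspace_le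
          convex_halfspace_ge) (force simp: inner_diff_right abs_le_iff)
    obtain p where p: "p \<in> G" "u \<bullet> p < u \<bullet> w" using edge_point_below[OF e u(4)] .
    have "u \<bullet> w = u \<bullet> m + \<beta>" using u(2,5) by (simp add: inner_add_right norm_eq_1)
    \<comment> \<open>For \<open>\<beta> \<le> 0\<close> the lower boundary of the strip would be
      the line of the edge itself, leaving no room for \<open>p\<close>.\<close>
    then have "\<beta> > 0" using p G by auto
    then show ?thesis using G by (force simp: inner_diff_right abs_le_iff)
  qed
  have reflect_vertex: "2 *\<^sub>R m - v \<in> G" if v: "v extreme_point_of G" for v
  proof (rule ccontr)
    assume notin: "2 *\<^sub>R m - v \<notin> G"
    have vG: "v \<in> G" using v by (simp add: extreme_point_of_def)
    have "2 *\<^sub>R m + (-1) *\<^sub>R v \<in> affine hull G"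
      using m hull_inc[OF vG, of affine] by (intro mem_affine affine_affine_hull) auto
    then have hull: "2 *\<^sub>R m - v \<in> affine hull G" by simp
    obtain u0 where u0: "maxface G u0 facet_of G"
        "\<And>y. y \<in> maxface G u0 \<Longrightarrow> u0 \<bullet> y < u0 \<bullet> (2 *\<^sub>R m - v)"
      using polytope_facet_separates[OF polytope_G hull notin] by metis
    have "maxface G u0 edge_of G" using u0(1) aff_dim_G by (auto simp: facet_of_def edge_of_def)
    moreover from this obtain a b where "maxface G u0 = closed_segment a b"
      using polytope_edge_segment[OF polytope_G] by metis
    ultimately obtain w z where e: "csegment w z edge_of G" "csegment w z = maxface G u0"
      using segment_eq_csegment by metis
    obtain u c \<beta> where u: "u \<in> directions G" "norm u = 1" "u \<bullet> z = 0" "maxface G u = csegment w z"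
        "w = m + \<beta> *\<^sub>R u" "c > 0" "\<And>v. v \<in> directions G \<Longrightarrow> u0 \<bullet> v = c * (u \<bullet> v)"
      using edge_frame[OF e] by metis
    have w: "w \<in> maxface G u0" unfolding e(2)[symmetric] in_csegment_iff by force
    have wG: "w \<in> G" by (rule edge_center_in[OF e(1)])
    \<comment> \<open>That the reflected point violates this facet means
      \<open>u \<bullet> (v - m) < - \<beta>\<close>, which puts \<open>v\<close> outside the
      strip.\<close>
    have "0 < u0 \<bullet> (2 *\<^sub>R m - v - w)" using u0(2)[OF w] by (simp add: inner_diff_right)
    also have "\<dots> = c * (u \<bullet> (2 *\<^sub>R m - v - w))"
      by (rule u(7)[OF affine_hull_diff_in_directions[OF hull hull_inc[OF wG]]])
    finally have "0 < u \<bullet> (2 *\<^sub>R m - v - w)" using u(6) by (simp add: zero_less_mult_iff)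
    moreover have "2 *\<^sub>R m - v - w = - (v - m) - \<beta> *\<^sub>R u" using u(5) by (simp add: scaleR_2)
    ultimately have "0 < - (u \<bullet> (v - m)) - \<beta>"
      using u(2) by (simp add: inner_diff_right norm_eq_1)
    then show False using frame[OF e(1) u(1-5)] vG by (force simp: abs_le_iff)
  qed
  show ?thesis
  proof (rule zonal_if_edges_symmetric)
    fix w z assume e: "csegment w z edge_of G"
    obtain u \<beta> where u: "u \<in> directions G" "norm u = 1" "u \<bullet> z = 0" "maxface G u = csegment w z"
        "w = m + \<beta> *\<^sub>R u"
      using edge_frame'[OF e] by metis
    have \<beta>: "\<beta> > 0" "\<And>x. x \<in> G \<Longrightarrow> \<bar>u \<bullet> (x - m)\<bar> \<le> \<beta>" using frame[OF e u] by auto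
    have uu: "u \<bullet> u = 1" using u(2) by (simp add: norm_eq_1)
    \<comment> \<open>The reflected endpoints attain the minimum of \<open>u\<close>; having
      distance \<open>r\<close> from \<open>m\<close> they are vertices, so they are the two ends of
      the opposite face.\<close>
    let ?F = "maxface G (- u)" and ?a = "2 *\<^sub>R m - (w + z)" and ?b = "2 *\<^sub>R m - (w - z)"
    note ext = edge_endpoints_extreme[OF e]
    have ab: "?a \<in> G" "?b \<in> G" using ext reflect_vertex by auto
    have inF: "x \<in> ?F" if "x \<in> G" "u \<bullet> (x - m) = - \<beta>" for x
      using that \<beta>(2) by (force simp: maxface_def inner_diff_right abs_le_iff)
    have ab_m: "?a - m = - (\<beta> *\<^sub>R u) - z" "?b - m = - (\<beta> *\<^sub>R u) + z" using u(5) by (simp_all add: scaleR_2)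
    have "u \<bullet> (?a - m) = - \<beta>" "u \<bullet> (?b - m) = - \<beta>"
      unfolding ab_m using u(3) uu by (simp_all add: inner_diff_right inner_add_right)
    then have abF: "?a \<in> ?F" "?b \<in> ?F" using ab inF by auto
    have F: "?F face_of G" by (rule maxface_face_of[OF convex_G])
    have "?F \<noteq> G"
    proof
      assume "?F = G"
      then have "w \<in> ?F" using edge_center_in[OF e] by simp
      then have "u \<bullet> w = u \<bullet> ?a" using inner_maxface_eq[OF _ abF(1)] by force
      then have "u \<bullet> (w - m) = u \<bullet> (?a - m)" by (simp add: inner_diff_right)
      then show False using \<open>u \<bullet> (?a - m) = - \<beta>\<close> u(5) uu \<beta>(1) by simp
    qed
    then have "aff_dim ?F < 2" using face_of_aff_dim_lt[OF convex_G F] aff_dim_G by simp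
    moreover have ne: "?a \<noteq> ?b"
    proof
      assume "?a = ?b"
      then have "z \<bullet> ?a = z \<bullet> ?b" by (rule arg_cong)
      then have "z \<bullet> z = 0" by (simp add: inner_diff_right inner_add_right)
      then show False using csegment_edge_nonzero[OF e] by simp
    qed
    have "aff_dim {?a, ?b} \<le> aff_dim ?F" using abF by (intro aff_dim_subset) auto
    then have "1 \<le> aff_dim ?F" using ne by (simp add: aff_dim_2)
    ultimately have "?F edge_of G" using F by (simp add: edge_of_def)
    moreover obtain p q where pq: "?F = closed_segment p q"
      using polytope_edge_segment[OF polytope_G calculation] by metis
    have "?a extreme_point_of ?F" "?b extreme_point_of ?F"
    proof -
      have "?a - m = - ((w + z) - m)" "?b - m = - ((w - z) - m)" by (simp_all add: scaleR_2)
      then have "norm (?a - m) = norm ((w + z) - m)" "norm (?b - m) = norm ((w - z) - m)"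
        by (metis norm_minus_cancel)+
      then show "?a extreme_point_of ?F" "?b extreme_point_of ?F"
        using ext extreme extreme_if_norm_eq ab extreme_point_of_face[OF F] abF by auto
    qed
    then have "{?a, ?b} = {p, q}" using ne unfolding pq extreme_point_of_segment by auto
    then have "closed_segment ?a ?b = ?F" unfolding pq closed_segment_eq[symmetric] by simp
    moreover have "closed_segment ?a ?b = csegment (2 *\<^sub>R m - w) z" by (simp add: algebra_simps)
    moreover have "w \<noteq> m" using u(5) uu \<beta>(1) by auto
    ultimately show "csegment (2 *\<^sub>R m - w) z edge_of G \<and> w \<noteq> m" by simp
  qed
qed

section \<open>Polygons under the section condition\<close>

text \<open>The bisector cuts \<open>G\<close> in a segment of the normal line through
  \<open>m\<close>, with \<open>w\<close> as one end. The other end is equally far from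
  \<open>m\<close>, so it is the reflection of \<open>w\<close>. It lies on some edge, at relative
  position \<open>t\<close>, and comparing Pythagoras for the two edges gives the relation of their
  lengths.\<close>

lemma opposite_edge:
  assumes e: "csegment w z edge_of G"
    and central: "\<And>x. x extreme_point_of (G \<inter> {x. z \<bullet> (x - w) = 0}) \<Longrightarrow> norm (x - m) = norm (w - m)"
  obtains w' y t where "csegment w' y edge_of G" "2 *\<^sub>R m - w = w' + t *\<^sub>R y" "\<bar>t\<bar> < 1"
    "(norm z)\<^sup>2 = (1 - t\<^sup>2) * (norm y)\<^sup>2" "w \<noteq> m"
proof -
  obtain u \<beta> where u: "u \<in> directions G" "norm u = 1" "u \<bullet> z = 0" "maxface G u = csegment w z"
      "w = m + \<beta> *\<^sub>R u"
    using edge_frame'[OF e] by metis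
  have uu: "u \<bullet> u = 1" using u(2) by (simp add: norm_eq_1)
  note z0 = csegment_edge_nonzero[OF e] and zL = edge_in_directions[OF e]
  have zu: "z \<bullet> u = 0" using u(3) by (simp add: inner_commute)
  define N where "N = G \<inter> {x. z \<bullet> (x - w) = 0}"
  have hyp: "{x. z \<bullet> (x - w) = 0} = {x. z \<bullet> x = z \<bullet> w}" by (auto simp: inner_diff_right)
  have N: "compact N" "convex N"
    unfolding N_def hyp using polytope_imp_compact[OF polytope_G] convex_G
    by (auto intro!: compact_Int_closed closed_hyperplane convex_Int convex_hyperplane)
  have wG: "w \<in> G" by (rule edge_center_in[OF e])
  then have "w \<in> N" by (simp add: N_def)
  have line: "x = m + (u \<bullet> (x - m)) *\<^sub>R u" if "x \<in> N" for x
  proof -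
    have "x \<in> affine hull G" using that by (auto simp: N_def hull_inc)
    then have "x - m \<in> directions G" using m affine_hull_diff_in_directions by blast
    moreover have "z \<bullet> (x - m) = 0"
      using that u(5) zu by (simp add: N_def inner_diff_right inner_add_right)
    ultimately have "x - m = (u \<bullet> (x - m)) *\<^sub>R u"
      using orthogonal_expansion[OF u(1,2) zL z0 u(3), of "x - m"] by simp
    then show ?thesis by (simp add: algebra_simps)
  qed
  obtain x1 where x1: "x1 \<in> maxface N (- u)" using maxface_nonempty[OF N(1)] \<open>w \<in> N\<close> by blast
  then have x1N: "x1 \<in> N" using maxface_subset by blast
  have min: "u \<bullet> x1 \<le> u \<bullet> x" if "x \<in> N" for x using x1 that by (auto simp: maxface_def)
  have "maxface N (- u) = {x1}"
  proof -
    have "x = x1" if "x \<in> maxface N (- u)" for x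
    proof -
      have "u \<bullet> x = u \<bullet> x1" using inner_maxface_eq[OF that x1] by simp
      moreover have "x \<in> N" using that maxface_subset by blast
      ultimately show ?thesis using line[of x] line[of x1] x1N by (simp add: inner_diff_right)
    qed
    then show ?thesis using x1 by blast
  qed
  then have "x1 extreme_point_of N"
    using maxface_face_of[OF N(2), of "- u"] by (simp add: face_of_singleton)
  then have norm_x1: "norm (x1 - m) = norm (w - m)" using central unfolding N_def by blast
  \<comment> \<open>The section does not shrink to \<open>w\<close>: join a point \<open>p\<close>
    below the edge to an endpoint \<open>q\<close> on the other side of the bisector and take the
    crossing point.\<close>
  obtain y where y: "y \<in> N" "u \<bullet> y < u \<bullet> w"
  proof -
    obtain p where p: "p \<in> G" "u \<bullet> p < u \<bullet> w" using edge_point_below[OF e u(4)] .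
    have "\<exists>q\<in>G. u \<bullet> q = u \<bullet> w \<and> (z \<bullet> (p - w) > 0 \<longrightarrow> z \<bullet> (q - w) < 0)
        \<and> (z \<bullet> (p - w) \<le> 0 \<longrightarrow> z \<bullet> (q - w) > 0)"
    proof (cases "z \<bullet> (p - w) > 0")
      case True
      then show ?thesis using u(3) z0 edge_of_imp_subset[OF e]
        by (intro bexI[of _ "w - z"]) (auto simp: inner_diff_right)
    next
      case False
      then show ?thesis using u(3) z0 edge_of_imp_subset[OF e]
        by (intro bexI[of _ "w + z"]) (auto simp: inner_add_right)
    qed
    then obtain q where q: "q \<in> G" "u \<bullet> q = u \<bullet> w" "z \<bullet> (p - w) > 0 \<longrightarrow> z \<bullet> (q - w) < 0"
        "z \<bullet> (p - w) \<le> 0 \<longrightarrow> z \<bullet> (q - w) > 0"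
      by blast
    define i where "i = z \<bullet> (p - w)"
    define j where "j = z \<bullet> (q - w)"
    have ij: "i > 0 \<and> j < 0 \<or> i \<le> 0 \<and> j > 0" using q by (auto simp: i_def j_def)
    define k where "k = i / (i - j)"
    have k: "0 \<le> k" "k < 1" "(1 - k) * i + k * j = 0"
      using ij by (auto simp: k_def field_simps)
    define y where "y = (1 - k) *\<^sub>R p + k *\<^sub>R q"
    have "y \<in> G" unfolding y_def using k by (intro convexD[OF convex_G p(1) q(1)]) auto
    moreover have "y - w = (1 - k) *\<^sub>R (p - w) + k *\<^sub>R (q - w)" by (simp add: y_def algebra_simps)
    then have "z \<bullet> (y - w) = 0" using k(3) by (simp add: inner_add_right i_def j_def)
    ultimately have "y \<in> N" by (simp add: N_def)
    moreover have "u \<bullet> y = u \<bullet> w - (1 - k) * (u \<bullet> w - u \<bullet> p)"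
      unfolding y_def inner_add_right inner_scaleR_right q(2) by (simp add: algebra_simps)
    then have "u \<bullet> y < u \<bullet> w" using k p(2) by simp
    ultimately show thesis by (rule that)
  qed
  define s where "s = u \<bullet> (x1 - m)"
  have x1s: "x1 = m + s *\<^sub>R u" using line[OF x1N] by (simp add: s_def)
  \<comment> \<open>Equal distance leaves \<open>s = \<beta>\<close> or
    \<open>s = - \<beta>\<close>, and only the latter lies below \<open>w\<close>.\<close>
  have "\<bar>s\<bar> = \<bar>\<beta>\<bar>" using norm_x1 u(2,5) x1s by simp
  moreover have "u \<bullet> x1 < u \<bullet> w" using y min[OF y(1)] by simp
  then have "s < \<beta>" unfolding x1s u(5) using uu by (simp add: inner_add_right)
  ultimately have s: "s = - \<beta>" and \<beta>: "\<beta> > 0" by auto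
  have x1_eq: "x1 = 2 *\<^sub>R m - w" using x1s s u(5) by (simp add: scaleR_2)
  have x1G: "x1 \<in> G" using x1N by (simp add: N_def)
  \<comment> \<open>Otherwise the segment from \<open>w\<close> could be prolonged beyond
    \<open>x1\<close> inside the section, against the minimality of \<open>x1\<close>.\<close>
  have "x1 \<notin> rel_interior G"
  proof
    assume "x1 \<in> rel_interior G"
    then obtain k where k: "k > 1" "(1 - k) *\<^sub>R w + k *\<^sub>R x1 \<in> G"
      using convex_rel_interior_if[OF convex_G] hull_inc[OF wG] by (metis order_refl)
    have "(1 - k) *\<^sub>R w + k *\<^sub>R x1 - w = k *\<^sub>R (x1 - w)" by (simp add: algebra_simps)
    moreover have "z \<bullet> (x1 - w) = 0" using x1N by (simp add: N_def)
    ultimately have "(1 - k) *\<^sub>R w + k *\<^sub>R x1 \<in> N" using k by (simp add: N_def)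
    from min[OF this] have "(1 - k) * (u \<bullet> x1) \<le> (1 - k) * (u \<bullet> w)"
      by (simp add: inner_add_right algebra_simps)
    then have "u \<bullet> w \<le> u \<bullet> x1" using k(1) by (simp add: mult_le_cancel_left)
    then show False using \<open>u \<bullet> x1 < u \<bullet> w\<close> by simp
  qed
  then obtain F where F: "F facet_of G" "x1 \<in> F"
    using rel_boundary_of_polyhedron[OF polytope_imp_polyhedron[OF polytope_G]] x1G by blast
  then have "F edge_of G" using aff_dim_G by (auto simp: facet_of_def edge_of_def)
  moreover obtain a b where "F = closed_segment a b"
    using polytope_edge_segment[OF polytope_G calculation] by metis
  ultimately obtain w' v where e': "csegment w' v edge_of G" "F = csegment w' v"
    using segment_eq_csegment by metis
  then obtain t where t: "\<bar>t\<bar> \<le> 1" "x1 = w' + t *\<^sub>R v" using F(2) in_csegment_iff by blast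
  have v: "v \<bullet> (w' - m) = 0" "(norm (w' - m))\<^sup>2 + (norm v)\<^sup>2 = r\<^sup>2" using edge_orthogonal[OF e'(1)] by auto
  have "(norm (x1 - m))\<^sup>2 = (norm ((w' - m) + t *\<^sub>R v))\<^sup>2" using t by (simp add: algebra_simps)
  also have "\<dots> = (norm (w' - m))\<^sup>2 + t\<^sup>2 * (norm v)\<^sup>2"
    using v(1) unfolding power2_norm_eq_inner inner_add_left inner_add_right
    by (simp add: inner_commute power2_eq_square)
  finally have "(norm (w - m))\<^sup>2 = r\<^sup>2 - (norm v)\<^sup>2 + t\<^sup>2 * (norm v)\<^sup>2" using norm_x1 v(2) by simp
  then have zv: "(norm z)\<^sup>2 = (1 - t\<^sup>2) * (norm v)\<^sup>2"
    using edge_orthogonal(2)[OF e] by (simp add: algebra_simps)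
  have "\<bar>t\<bar> \<noteq> 1"
  proof
    assume "\<bar>t\<bar> = 1"
    then have "t\<^sup>2 = 1" by (metis power2_abs power_one)
    then show False using zv z0 by simp
  qed
  moreover have "w \<noteq> m" using u(5) uu \<beta> by auto
  ultimately show thesis using that[of w' v t] e'(1) t zv x1_eq by auto
qed

text \<open>Take a longest edge \<open>e\<close> whose reflection is not an edge. The edge crossed by the reflected
  midpoint of \<open>e\<close> is at least as long: either its own reflection is an edge, which then must be \<open>e\<close>,
  or the lengths agree and it is the reflection of \<open>e\<close>.\<close>

theorem zonal_if_sections_inscribed:
  assumes central: "\<And>w z x. csegment w z edge_of G \<Longrightarrow>
      x extreme_point_of (G \<inter> {x. z \<bullet> (x - w) = 0}) \<Longrightarrow> norm (x - m) = norm (w - m)"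
  shows "zonal G"
proof -
  define B where "B = {(w, z). csegment w z edge_of G \<and> \<not> csegment (2 *\<^sub>R m - w) z edge_of G}"
  have "B = {}"
  proof (rule ccontr)
    assume "B \<noteq> {}"
    have "finite B"
    proof -
      let ?V = "{v. v extreme_point_of G}"
      have "finite ?V"
        using finite_polyhedron_extreme_points polytope_imp_polyhedron polytope_G by blast
      then have fin: "finite ((\<lambda>(a, b). ((1/2) *\<^sub>R (a + b), (1/2) *\<^sub>R (b - a))) ` (?V \<times> ?V))" by blast
      have "(w, z) \<in> (\<lambda>(a, b). ((1/2) *\<^sub>R (a + b), (1/2) *\<^sub>R (b - a))) ` (?V \<times> ?V)"
        if "csegment w z edge_of G" for w z
        using edge_endpoints_extreme[OF that]
        by (intro image_eqI[of _ _ "(w - z, w + z)"]) (auto simp flip: scaleR_2)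
      then have "B \<subseteq> (\<lambda>(a, b). ((1/2) *\<^sub>R (a + b), (1/2) *\<^sub>R (b - a))) ` (?V \<times> ?V)"
        by (auto simp: B_def)
      then show ?thesis using fin by (rule finite_subset)
    qed
    then have "Max ((norm \<circ> snd) ` B) \<in> (norm \<circ> snd) ` B" using \<open>B \<noteq> {}\<close> by (intro Max_in) auto
    then obtain w z where wz: "(w, z) \<in> B" "norm z = Max ((norm \<circ> snd) ` B)" by auto
    have longest: "norm y \<le> norm z" if "(w', y) \<in> B" for w' y
      using that \<open>finite B\<close> unfolding wz(2) by (intro Max_ge) (auto intro: image_eqI[of _ _ "(w', y)"])
    have e: "csegment w z edge_of G" and bad: "\<not> csegment (2 *\<^sub>R m - w) z edge_of G"
      using wz by (auto simp: B_def)
    obtain w' y t where f: "csegment w' y edge_of G" "2 *\<^sub>R m - w = w' + t *\<^sub>R y" "\<bar>t\<bar> < 1"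
        "(norm z)\<^sup>2 = (1 - t\<^sup>2) * (norm y)\<^sup>2" "w \<noteq> m"
      using opposite_edge[OF e central[OF e]] by metis
    note z0 = csegment_edge_nonzero[OF e] and y0 = csegment_edge_nonzero[OF f(1)]
    show False
    proof (cases "(w', y) \<in> B")
      case False
      then have f': "csegment (2 *\<^sub>R m - w') y edge_of G" using f(1) by (simp add: B_def)
      have "w = (2 *\<^sub>R m - w') + (- t) *\<^sub>R y" using f(2) by (simp add: algebra_simps)
      \<comment> \<open>\<open>w\<close> is relatively interior to its own edge and to the
        reflection of the opposite one, and faces with a common relative interior point are
        equal.\<close>
      then have "w \<in> rel_interior (csegment (2 *\<^sub>R m - w') y)"
        using csegment_rel_interior[of "- t" y] f(3) y0 by simp
      moreover have "w \<in> rel_interior (csegment w z)" using csegment_rel_interior[of 0 z w] z0 by simp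
      ultimately have "csegment (2 *\<^sub>R m - w') y = csegment w z"
        using e f' by (intro face_of_eq[of _ G]) (auto simp: edge_of_def)
      then have "csegment (2 *\<^sub>R m - w) z = csegment (2 *\<^sub>R m - (2 *\<^sub>R m - w')) y"
        by (metis csegment_reflect)
      then have "csegment (2 *\<^sub>R m - w) z = csegment w' y" by simp
      then show False using bad f(1) by metis
    next
      case True
      \<comment> \<open>\<open>z\<close> is longest among the pairs in \<open>B\<close>, so the
        factor \<open>1 - t\<^sup>2\<close> cannot be below one.\<close>
      then have "(norm y)\<^sup>2 \<le> (1 - t\<^sup>2) * (norm y)\<^sup>2" using longest f(4) by (metis norm_ge_zero power_mono)
      then have "t\<^sup>2 * (norm y)\<^sup>2 \<le> 0" by (simp add: algebra_simps)
      then have t: "t = 0" using y0 by (auto simp: mult_le_0_iff)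
      then have w': "w' = 2 *\<^sub>R m - w" using f(2) by simp
      obtain u \<beta> where u: "u \<in> directions G" "norm u = 1" "u \<bullet> z = 0" "maxface G u = csegment w z"
          "w = m + \<beta> *\<^sub>R u"
        using edge_frame'[OF e] by metis
      have "\<beta> \<noteq> 0" using f(5) u(5) by auto
      have "w' - m = - (\<beta> *\<^sub>R u)" using w' u(5) by (simp add: scaleR_2)
      \<comment> \<open>\<open>\<beta> \<noteq> 0\<close> makes both edges orthogonal to
        \<open>u\<close>, hence parallel.\<close>
      then have "y \<bullet> u = 0" using edge_orthogonal(1)[OF f(1)] \<open>\<beta> \<noteq> 0\<close> by simp
      then have "y = ((z \<bullet> y) / (z \<bullet> z)) *\<^sub>R z"
        using orthogonal_expansion[OF u(1,2) edge_in_directions[OF e] z0 u(3) edge_in_directions[OF f(1)]]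
        by (simp add: inner_commute)
      then obtain k where k: "y = k *\<^sub>R z" by blast
      have "norm z = norm y" using f(4) t by simp
      then have "\<bar>k\<bar> = 1" using k z0 by simp
      then have "y = z \<or> y = - z" using k by (auto simp: abs_if split: if_splits)
      then have "csegment w' y = csegment w' z" by (auto simp: closed_segment_commute)
      then show False using f(1) bad w' by metis
    qed
  qed
  then have "csegment (2 *\<^sub>R m - w) z edge_of G" if "csegment w z edge_of G" for w z
    using that by (auto simp: B_def)
  moreover have "w \<noteq> m" if e: "csegment w z edge_of G" for w z
    using opposite_edge[OF e central[OF e]] by metis
  ultimately show ?thesis using zonal_if_edges_symmetric by blast
qed

end

section \<open>Zonotopes\<close>

lemma closed_segment_translate: "closed_segment c (c + v) = {c} + closed_segment 0 v"
  using closed_segment_plus_parallel[of 0 1 c v 0] by simp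

text \<open>Each \<open>[- z, z]\<close> is \<open>[0, 2 z]\<close> translated by
  \<open>- z\<close>. Collecting the translations in the starting point leaves segments with one end
  at the origin, the form in which edges are split off.\<close>

lemma zonotope_induct [consumes 1, case_names point segment]:
  fixes Z :: "'a::euclidean_space set"
  assumes "zonotope Z" and point: "\<And>t. R {t}" and step: "\<And>Q z. R Q \<Longrightarrow> R (Q + closed_segment 0 z)"
  shows "R Z"
proof -
  have "R ({t} + (\<Sum>z\<leftarrow>zs. closed_segment (- z) z))" for t zs
  proof (induction zs arbitrary: t)
    case Nil
    then show ?case using point by simp
  next
    case (Cons z zs)
    have "closed_segment (- z) z = {- z} + closed_segment 0 (2 *\<^sub>R z)"
      using closed_segment_translate[of "- z" "2 *\<^sub>R z"] by (simp add: scaleR_2)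
    moreover have "{t - z} = {t} + {- z}" by (simp add: set_plus_def)
    ultimately have "{t} + (\<Sum>z\<leftarrow>z # zs. closed_segment (- z) z)
        = ({t - z} + (\<Sum>z\<leftarrow>zs. closed_segment (- z) z)) + closed_segment 0 (2 *\<^sub>R z)"
      by (simp add: ac_simps)
    then show ?case using step Cons by simp
  qed
  moreover have "(+) t ` A = {t} + A" for t and A :: "'a set" by (auto simp: set_plus_def)
  ultimately show ?thesis using assms(1) by (auto simp: zonotope_def)
qed

lemma polytope_plus:
  assumes "polytope A" "polytope B"
  shows "polytope (A + B)"
proof -
  obtain S T where "finite S" "A = convex hull S" "finite T" "B = convex hull T"
    using assms by (auto simp: polytope_def)
  then show ?thesis
    unfolding polytope_def using finite_set_plus[of S T] convex_hull_set_plus[of S T] by metis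
qed

lemma polytope_segment: "polytope (closed_segment a b)"
  unfolding segment_convex_hull by (simp add: polytope_convex_hull)

lemma segment_scaleR_oriented:
  obtains c where "closed_segment p (p + s *\<^sub>R v) = closed_segment c (c + \<bar>s\<bar> *\<^sub>R v)"
proof (cases "s \<ge> 0")
  case False
  then have "closed_segment p (p + s *\<^sub>R v) = closed_segment (p + s *\<^sub>R v) (p + s *\<^sub>R v + \<bar>s\<bar> *\<^sub>R v)"
    by (simp add: closed_segment_commute)
  then show thesis by (rule that)
qed (use that in auto)

text \<open>The segments are added one at a time. A face of \<open>Q + [0, z]\<close> is a face of
  \<open>Q\<close> plus either one endpoint of the segment or all of it. In the second case the edge
  is shared: a fraction \<open>k\<close> of \<open>v\<close> comes from \<open>Q\<close> and a
  fraction \<open>l\<close> from \<open>z\<close>, with \<open>k + l = 1\<close>, and both parts are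
  summands.\<close>

theorem zonotope_edge_summand:
  fixes Z :: "'a::euclidean_space set"
  assumes "zonotope Z" "closed_segment x (x + v) edge_of Z"
  shows "\<exists>Q. Z = Q + closed_segment 0 v"
proof -
  have "polytope Z \<and> Z \<noteq> {} \<and>
    (\<forall>x v. closed_segment x (x + v) edge_of Z \<longrightarrow> (\<exists>Q. Z = Q + closed_segment 0 v))"
    using assms(1)
  proof (induction rule: zonotope_induct)
    case (point t)
    have "\<not> closed_segment x (x + v) edge_of {t}" for x v
    proof
      assume e: "closed_segment x (x + v) edge_of {t}"
      then have "x \<in> {t}" "x + v \<in> {t}" using edge_of_imp_subset ends_in_segment by blast+
      moreover have "v \<noteq> 0" using e by (simp add: segment_edge_of_iff)
      ultimately show False by simp
    qed
    then show ?case by (simp add: polytope_sing)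
  next
    case (segment Q z)
    then have Q: "polytope Q" "Q \<noteq> {}" by auto
    let ?Z = "Q + closed_segment 0 z"
    have Z: "polytope ?Z" using Q polytope_plus polytope_segment by blast
    have Zne: "?Z \<noteq> {}" using Q by (auto simp: set_plus_def)
    have IH: "\<exists>R. Q = R + closed_segment 0 y" if "maxface Q u = closed_segment x (x + y)" "y \<noteq> 0"
      for u x y
    proof -
      have "closed_segment x (x + y) face_of Q"
        using maxface_face_of[OF polytope_imp_convex[OF Q(1)], of u] that(1) by simp
      then show ?thesis using segment that(2) by (auto simp: segment_edge_of_iff)
    qed
    have "\<exists>R. ?Z = R + closed_segment 0 v" if e: "closed_segment x (x + v) edge_of ?Z" for x v
    proof -
      have v0: "v \<noteq> 0" and "closed_segment x (x + v) face_of ?Z" using e by (auto simp: segment_edge_of_iff)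
      then obtain u where u: "closed_segment x (x + v) = maxface ?Z u"
        using polytope_face_eq_maxface[OF Z] by (metis ends_in_segment(1) empty_iff)
      have sum: "maxface ?Z u = maxface Q u + maxface (closed_segment 0 z) u"
        using Q polytope_imp_compact by (intro maxface_plus) auto
      show ?thesis
      proof (cases "u \<bullet> z = 0")
        case False
        then obtain \<zeta> where \<zeta>: "maxface (closed_segment 0 z) u = {\<zeta>}" using maxface_segment by metis
        have "maxface Q u = {- \<zeta>} + closed_segment x (x + v)"
          unfolding u sum \<zeta> by (force simp: set_plus_def)
        also have "\<dots> = closed_segment (x - \<zeta>) (x - \<zeta> + v)"
          using closed_segment_plus_parallel[of 0 1 "- \<zeta>" v x] by simp
        finally obtain R where "Q = R + closed_segment 0 v" using IH v0 by metis
        then have "?Z = (R + closed_segment 0 z) + closed_segment 0 v" by (simp add: ac_simps)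
        then show ?thesis by blast
      next
        case True
        define F where "F = maxface Q u"
        have eq: "closed_segment x (x + v) = F + closed_segment 0 z"
          unfolding u sum F_def maxface_segment_orthogonal[OF True] ..
        have F: "polytope F" "F \<noteq> {}"
          using polytope_maxface[OF Q(1)] maxface_nonempty[OF polytope_imp_compact[OF Q(1)] Q(2)]
          by (auto simp: F_def)
        have line: "\<exists>k. q = x + k *\<^sub>R v" if "q \<in> closed_segment x (x + v)" for q
          using that by (auto simp: in_segment algebra_simps)
        have "\<exists>k. q = x + k *\<^sub>R v" if "q \<in> F" for q
          using set_plus_intro[of q F 0 "closed_segment 0 z"] that eq line by auto
        moreover obtain a b where ab: "F = closed_segment a b"
        proof -
          have "collinear F" unfolding collinear_def
          proof (intro exI[of _ v] ballI)
            fix q q' assume "q \<in> F" "q' \<in> F"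
            then obtain k k' where "q = x + k *\<^sub>R v" "q' = x + k' *\<^sub>R v"
              using \<open>\<And>q. q \<in> F \<Longrightarrow> \<exists>k. q = x + k *\<^sub>R v\<close> by metis
            then show "\<exists>c. q - q' = c *\<^sub>R v"
              by (intro exI[of _ "k - k'"]) (simp add: algebra_simps)
          qed
          then show thesis
            using compact_convex_collinear_segment F polytope_imp_compact polytope_imp_convex that
            by metis
        qed
        ultimately obtain i j where ij: "a = x + i *\<^sub>R v" "b = x + j *\<^sub>R v" by (meson ends_in_segment)
        then have "b = a + (j - i) *\<^sub>R v" by (simp add: algebra_simps)
        then obtain p where p: "F = closed_segment p (p + \<bar>j - i\<bar> *\<^sub>R v)"
          using ab segment_scaleR_oriented[of a "j - i" v] by metis
        have "a + z \<in> closed_segment x (x + v)" unfolding eq ab by (intro set_plus_intro) auto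
        then obtain s where "a + z = x + s *\<^sub>R v" using line by blast
        then have "z = (s - i) *\<^sub>R v" using ij(1) by (simp add: algebra_simps)
        then obtain c where c: "closed_segment 0 z = closed_segment c (c + \<bar>s - i\<bar> *\<^sub>R v)"
          using segment_scaleR_oriented[of 0 "s - i" v] by auto
        define k l where "k = \<bar>j - i\<bar>" and "l = \<bar>s - i\<bar>"
        have kl: "0 \<le> k" "0 \<le> l" by (auto simp: k_def l_def)
        have "closed_segment x (x + v) = closed_segment (p + c) (p + c + (k + l) *\<^sub>R v)"
          unfolding eq p c using closed_segment_plus_parallel[of k l p v c] kl by (simp add: k_def l_def)
        then have "norm v \<le> norm ((k + l) *\<^sub>R v)" "norm ((k + l) *\<^sub>R v) \<le> norm v"
          using norm_le_if_segment_subset by blast+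
        then have "norm ((k + l) *\<^sub>R v) = norm v" by simp
        then have 1: "k + l = 1" using kl v0 by simp
        obtain R where R: "Q = R + closed_segment 0 (k *\<^sub>R v)"
        proof (cases "k = 0")
          \<comment> \<open>The face of \<open>Q\<close> is a vertex, so the induction hypothesis is
            silent; the zero segment is a summand of any set.\<close>
          case True
          then have "Q = Q + closed_segment 0 (k *\<^sub>R v)" by simp
          then show thesis by (rule that)
        next
          case False
          then show thesis using IH[of u p "k *\<^sub>R v"] p v0 that by (auto simp: F_def k_def)
        qed
        have "?Z = R + (closed_segment 0 (0 + k *\<^sub>R v) + closed_segment c (c + l *\<^sub>R v))"
          unfolding R c l_def by (simp add: add.assoc)
        also have "\<dots> = R + closed_segment c (c + v)"
          using closed_segment_plus_parallel[of k l 0 v c] kl 1 by simp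
        also have "\<dots> = (R + {c}) + closed_segment 0 v"
          unfolding closed_segment_translate by (simp add: ac_simps)
        finally show ?thesis by blast
      qed
    qed
    then show ?case using Z Zne by blast
  qed
  then show ?thesis using assms(2) by blast
qed

section \<open>Projections and sections along an edge\<close>

text \<open>Projection onto the hyperplane through \<open>c\<close> with normal \<open>z\<close>.
  Based at the center rather than at the midpoint of an edge, it depends on the edge only through
  its direction.\<close>

definition project_along :: "'a::euclidean_space \<Rightarrow> 'a \<Rightarrow> 'a \<Rightarrow> 'a" where
  "project_along c z x = x - ((z \<bullet> (x - c)) / (z \<bullet> z)) *\<^sub>R z"

lemma project_along_affine:
  assumes "s + t = 1"
  shows "project_along c z (s *\<^sub>R x + t *\<^sub>R y) = s *\<^sub>R project_along c z x + t *\<^sub>R project_along c z y"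
proof -
  have "s *\<^sub>R x + t *\<^sub>R y - c = s *\<^sub>R (x - c) + t *\<^sub>R (y - c)"
    using assms by (simp add: algebra_simps flip: scaleR_add_left)
  then have "z \<bullet> (s *\<^sub>R x + t *\<^sub>R y - c) = s * (z \<bullet> (x - c)) + t * (z \<bullet> (y - c))"
    by (simp add: inner_add_right)
  then show ?thesis
    unfolding project_along_def
    by (simp add: add_divide_distrib scaleR_add_left scaleR_diff_right)
qed

lemma inner_project_along:
  assumes "z \<noteq> 0"
  shows "z \<bullet> (project_along c z x - c) = 0"
  using assms by (simp add: project_along_def inner_diff_right)

lemma project_along_id: "z \<bullet> (x - c) = 0 \<Longrightarrow> project_along c z x = x"
  by (simp add: project_along_def)

lemma polytope_project_along:
  assumes "polytope P"
  shows "polytope (project_along c z ` P)"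
proof -
  define f where "f y = y - ((z \<bullet> y) / (z \<bullet> z)) *\<^sub>R z" for y
  have "linear f"
    by (intro linearI) (auto simp: f_def algebra_simps add_divide_distrib inner_add_right)
  moreover have "project_along c z ` P = (+) c ` f ` (+) (- c) ` P"
    by (auto simp: f_def project_along_def image_image algebra_simps)
  ultimately show ?thesis
    using assms by (simp only: polytope_translation_eq polytope_linear_image)
qed

lemma norm_project_along:
  assumes "z \<noteq> 0"
  shows "(norm (x - c))\<^sup>2 = (norm (project_along c z x - c))\<^sup>2 + (z \<bullet> (x - c))\<^sup>2 / (z \<bullet> z)"
proof -
  define k where "k = (z \<bullet> (x - c)) / (z \<bullet> z)"
  define y where "y = project_along c z x - c"
  have zy: "z \<bullet> y = 0" unfolding y_def by (rule inner_project_along[OF assms])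
  have x: "x - c = y + k *\<^sub>R z" by (simp add: y_def project_along_def k_def)
  have "(norm (x - c))\<^sup>2 = (norm y)\<^sup>2 + k\<^sup>2 * (z \<bullet> z)"
    unfolding x power2_norm_eq_inner using zy
    by (simp add: inner_add_left inner_add_right inner_commute power2_eq_square)
  moreover have "k\<^sup>2 * (z \<bullet> z) = (z \<bullet> (x - c))\<^sup>2 / (z \<bullet> z)"
    using assms by (simp add: k_def power2_eq_square)
  ultimately show ?thesis by (simp add: y_def)
qed

text \<open>An extreme point is a face, and an affine map pulls faces back to faces.\<close>

lemma project_along_fiber_face:
  assumes "convex P" "p extreme_point_of (project_along c z ` P)"
  shows "{x \<in> P. project_along c z x = p} face_of P"
  unfolding face_of_def
proof (intro conjI ballI impI)
  let ?f = "project_along c z"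
  show "convex {x \<in> P. ?f x = p}"
  proof (rule convexI)
    fix x y and s t :: real assume *: "x \<in> {x \<in> P. ?f x = p}" "y \<in> {x \<in> P. ?f x = p}" "0 \<le> s" "0 \<le> t" "s + t = 1"
    then have "?f (s *\<^sub>R x + t *\<^sub>R y) = (s + t) *\<^sub>R p"
      by (simp add: project_along_affine flip: scaleR_add_left)
    then show "s *\<^sub>R x + t *\<^sub>R y \<in> {x \<in> P. ?f x = p}" using * convexD[OF assms(1)] by auto
  qed
  fix a b x assume *: "a \<in> P" "b \<in> P" "x \<in> {x \<in> P. ?f x = p}" "x \<in> open_segment a b"
  then obtain t where t: "0 < t" "t < 1" "x = (1 - t) *\<^sub>R a + t *\<^sub>R b" by (auto simp: in_segment)
  have p: "p = (1 - t) *\<^sub>R ?f a + t *\<^sub>R ?f b"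
    using * project_along_affine[of "1 - t" t c z a b] by (simp add: t(3))
  have "?f a = ?f b"
  proof (rule ccontr)
    assume "?f a \<noteq> ?f b"
    then have "p \<in> open_segment (?f a) (?f b)" using t p by (auto simp: in_segment)
    then show False using assms(2) * by (auto simp: extreme_point_of_def)
  qed
  then have "?f a = p" "?f b = p" using p by (simp_all flip: scaleR_add_left)
  then show "a \<in> {x \<in> P. ?f x = p}" "b \<in> {x \<in> P. ?f x = p}" using * by auto
qed simp

text \<open>The fiber over a vertex of the projection is again an edge. Both it and the projected edge
  are summands of \<open>P\<close>, hence each is at least as long as the other.\<close>

lemma project_along_edge:
  fixes P :: "'a::euclidean_space set"
  assumes P: "polytope P" and sphere: "\<And>v. v extreme_point_of P \<Longrightarrow> norm (v - c) = r"
    and summand: "\<And>x v. closed_segment x (x + v) edge_of P \<Longrightarrow> \<exists>Q. P = Q + closed_segment 0 v"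
    and e: "csegment w z edge_of P" and p: "p extreme_point_of (project_along c z ` P)"
  shows "p \<in> P" "(norm (p - c))\<^sup>2 = r\<^sup>2 - (norm z)\<^sup>2"
proof -
  let ?f = "project_along c z"
  define F where "F = {x \<in> P. ?f x = p}"
  have F: "F face_of P"
    unfolding F_def using project_along_fiber_face[OF polytope_imp_convex[OF P] p] .
  have polyF: "polytope F" using F P face_of_polytope_polytope by blast
  have z0: "z \<noteq> 0" by (rule csegment_edge_nonzero[OF e])
  have "F \<noteq> {}" using p by (auto simp: F_def extreme_point_of_def)
  have F_line: "\<exists>k. x - y = k *\<^sub>R z" if "x \<in> F" "y \<in> F" for x y
  proof -
    have "?f x = ?f y" using that by (simp add: F_def)
    then have "x - y = ((z \<bullet> (x - c)) / (z \<bullet> z) - (z \<bullet> (y - c)) / (z \<bullet> z)) *\<^sub>R z"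
      by (simp add: project_along_def algebra_simps)
    then show ?thesis by blast
  qed
  then have "collinear F" unfolding collinear_def by blast
  then obtain a b where ab: "F = closed_segment a b"
    using compact_convex_collinear_segment \<open>F \<noteq> {}\<close> polyF polytope_imp_compact polytope_imp_convex
    by metis
  \<comment> \<open>Because the edge is a summand, every point of \<open>P\<close> is the sum of a
    starting point and a point of the segment.\<close>
  have translate: "\<exists>q. closed_segment q (q + v) \<subseteq> P \<and> x \<in> closed_segment q (q + v)"
    if v: "closed_segment y (y + v) edge_of P" and x: "x \<in> P" for x y v
  proof -
    obtain Q where Q: "P = Q + closed_segment 0 v" using summand[OF v] by blast
    then obtain q k where qk: "q \<in> Q" "k \<in> closed_segment 0 v" "x = q + k" using x by (auto simp: set_plus_def)
    have "closed_segment q (q + v) = {q} + closed_segment 0 v" by (rule closed_segment_translate)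
    then show ?thesis using Q qk by (intro exI[of _ q]) (auto simp: set_plus_def)
  qed
  have ez: "closed_segment (w - z) (w - z + 2 *\<^sub>R z) edge_of P" using e by (simp add: scaleR_2)
  have fz: "?f (x + k *\<^sub>R z) = ?f x" for x k
  proof -
    have "z \<bullet> (x + k *\<^sub>R z - c) = z \<bullet> (x - c) + k * (z \<bullet> z)"
      by (simp add: inner_diff_right inner_add_right)
    then show ?thesis using z0 by (simp add: project_along_def add_divide_distrib scaleR_add_left)
  qed
  obtain x where x: "x \<in> F" using \<open>F \<noteq> {}\<close> by blast
  then obtain q where q: "closed_segment q (q + 2 *\<^sub>R z) \<subseteq> P" "x \<in> closed_segment q (q + 2 *\<^sub>R z)"
    using translate[OF ez] by (auto simp: F_def)
  have sub: "closed_segment q (q + 2 *\<^sub>R z) \<subseteq> F"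
  proof -
    have on_line: "\<exists>k. y = q + k *\<^sub>R z" if "y \<in> closed_segment q (q + 2 *\<^sub>R z)" for y
      using that by (auto simp: in_segment algebra_simps)
    then have "?f q = p" using q(2) x fz by (force simp: F_def)
    then show ?thesis using q(1) on_line fz by (force simp: F_def)
  qed
  have "norm (2 *\<^sub>R z) \<le> norm (b - a)"
    by (rule norm_le_if_segment_subset[of q _ a]) (use sub ab in simp)
  then have "a \<noteq> b" using z0 by auto
  then have ab_edge: "closed_segment a (a + (b - a)) edge_of P"
    using F ab by (simp add: segment_edge_of_iff)
  \<comment> \<open>A translate of the fiber through \<open>w - z\<close> is parallel to
    \<open>z\<close>, hence stays in the face \<open>csegment w z\<close>.\<close>
  have "norm (b - a) \<le> norm (2 *\<^sub>R z)"
  proof -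
    obtain u where u: "csegment w z = maxface P u"
      using polytope_face_eq_maxface[OF P] e by (metis edge_of_def ends_in_segment(1) empty_iff)
    have "u \<bullet> (2 *\<^sub>R z) = 0"
      using inner_edge_vector_eq_0[of "w - z" "2 *\<^sub>R z" P u] u by (simp add: scaleR_2)
    then have uz: "u \<bullet> z = 0" by simp
    obtain k where k: "b - a = k *\<^sub>R z" using F_line[of b a] ab by auto
    have w: "w - z \<in> maxface P u" using u by auto
    then obtain q' where q': "closed_segment q' (q' + (b - a)) \<subseteq> P"
        "w - z \<in> closed_segment q' (q' + (b - a))"
      using translate[OF ab_edge] maxface_subset by blast
    obtain i where i: "w - z = q' + i *\<^sub>R (b - a)" using q'(2) by (auto simp: in_segment algebra_simps)
    have "u \<bullet> q' = u \<bullet> (w - z)" using i k uz by (simp add: inner_add_right)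
    then have "q' \<in> maxface P u" "q' + (b - a) \<in> maxface P u"
      using q'(1) k uz by (auto intro!: maxface_memI[OF w] simp: inner_add_right)
    then have "closed_segment q' (q' + (b - a)) \<subseteq> maxface P u"
      using polytope_imp_convex[OF polytope_maxface[OF P]] by (intro closed_segment_subset)
    then have "closed_segment q' (q' + (b - a)) \<subseteq> closed_segment (w - z) (w - z + 2 *\<^sub>R z)"
      unfolding u[symmetric] by (simp add: scaleR_2)
    then show ?thesis by (rule norm_le_if_segment_subset)
  qed
  then have norm_ab: "norm (b - a) = 2 * norm z" using \<open>norm (2 *\<^sub>R z) \<le> norm (b - a)\<close> by simp
  define w' y where "w' = (1/2) *\<^sub>R (a + b)" and "y = (1/2) *\<^sub>R (b - a)"
  have Fw: "F = csegment w' y" unfolding ab w'_def y_def by (rule segment_eq_csegment)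
  have "closed_segment a b edge_of P" using ab_edge by simp
  then have "csegment w' y edge_of P" unfolding ab[symmetric] Fw .
  from edge_endpoints_extreme[OF this]
  have "norm (w' - y - c) = r" "norm (w' + y - c) = r" using sphere by auto
  note center = csegment_center_orthogonal[OF this]
  have ny: "norm y = norm z" using norm_ab by (simp add: y_def)
  obtain k where k: "b - a = k *\<^sub>R z" using F_line[of b a] ab by auto
  then have yk: "y = (k / 2) *\<^sub>R z" by (simp add: y_def)
  then have "k \<noteq> 0" using ny z0 by auto
  \<comment> \<open>The midpoint of the fiber lies on the hyperplane through \<open>c\<close>, so
    the projection fixes it and it equals \<open>p\<close>.\<close>
  then have "z \<bullet> (w' - c) = 0" using center(1) yk by simp
  then have "?f w' = w'" by (rule project_along_id)
  moreover have "w' \<in> F" unfolding Fw in_csegment_iff by (intro exI[of _ 0]) simp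
  ultimately have "w' = p" "w' \<in> P" by (auto simp: F_def)
  then show "p \<in> P" "(norm (p - c))\<^sup>2 = r\<^sup>2 - (norm z)\<^sup>2" using center(2) ny by auto
qed

text \<open>The projection has its vertices in \<open>P\<close>, so by convexity it lies in
  \<open>P\<close>; conversely the points of the section are fixed.\<close>

lemma projection_eq_section:
  fixes P :: "'a::euclidean_space set"
  assumes P: "polytope P" and sphere: "\<And>v. v extreme_point_of P \<Longrightarrow> norm (v - c) = r"
    and summand: "\<And>x v. closed_segment x (x + v) edge_of P \<Longrightarrow> \<exists>Q. P = Q + closed_segment 0 v"
    and e: "csegment w z edge_of P"
  shows "project_along c z ` P = P \<inter> {x. z \<bullet> (x - c) = 0}"
proof
  have z0: "z \<noteq> 0" by (rule csegment_edge_nonzero[OF e])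
  have "project_along c z ` P \<subseteq> P"
    by (rule polytope_subset_if_extreme[OF polytope_project_along[OF P] polytope_imp_convex[OF P]])
      (rule project_along_edge(1)[OF P sphere summand e])
  then show "project_along c z ` P \<subseteq> P \<inter> {x. z \<bullet> (x - c) = 0}"
    using inner_project_along[OF z0] by auto
  show "P \<inter> {x. z \<bullet> (x - c) = 0} \<subseteq> project_along c z ` P"
    using project_along_id by (force simp: image_iff)
qed

section \<open>Circumcenters\<close>

text \<open>Subtracting the two sphere equations places all vertices on a level set of the
  functional \<open>c - c'\<close>. It contains the affine hull and with it both centers.\<close>

lemma circumcenter_unique:
  fixes P :: "'a::euclidean_space set"
  assumes P: "polytope P" and "c \<in> affine hull P" "c' \<in> affine hull P"
    and c: "\<And>v. v extreme_point_of P \<Longrightarrow> norm (v - c) = r"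
    and c': "\<And>v. v extreme_point_of P \<Longrightarrow> norm (v - c') = r'"
  shows "c = c'"
proof -
  define k where "k = (r'\<^sup>2 - r\<^sup>2 + c \<bullet> c - c' \<bullet> c') / 2"
  have "(c - c') \<bullet> v = k" if "v extreme_point_of P" for v
  proof -
    have "(v - c) \<bullet> (v - c) = r\<^sup>2" "(v - c') \<bullet> (v - c') = r'\<^sup>2"
      using c[OF that] c'[OF that] by (simp_all flip: power2_norm_eq_inner)
    then show ?thesis
      by (simp add: k_def inner_diff_left inner_diff_right inner_commute)
  qed
  then have "P \<subseteq> {x. (c - c') \<bullet> x = k}"
    by (intro polytope_subset_if_extreme[OF P] convex_hyperplane) auto
  then have "affine hull P \<subseteq> {x. (c - c') \<bullet> x = k}" by (intro hull_minimal affine_hyperplane)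
  then have "(c - c') \<bullet> (c - c') = 0" using assms(2,3) by (auto simp: inner_diff_right)
  then show ?thesis by simp
qed

text \<open>\<open>m\<close> is the foot of the perpendicular from \<open>c\<close>. It turns a
  sphere of the ambient space into one centered in the affine hull, and the center of
  \<open>P\<close> into that of a face.\<close>

lemma orthogonal_center_in_affine_hull:
  assumes "P \<noteq> {}"
  obtains m where "m \<in> affine hull P" "\<And>y. y \<in> directions P \<Longrightarrow> y \<bullet> (m - c) = 0"
    "\<And>x. x \<in> affine hull P \<Longrightarrow> (norm (x - c))\<^sup>2 = (norm (x - m))\<^sup>2 + (norm (m - c))\<^sup>2"
proof -
  obtain p where p: "p \<in> P" using assms by blast
  have hull: "p + v \<in> affine hull P" if "v \<in> directions P" for v
  proof -
    have sub: "subspace ((\<lambda>x. (- p) + x) ` (affine hull P))"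
      using p by (intro affine_diffs_subspace affine_affine_hull hull_inc)
    have "x - y \<in> (\<lambda>x. (- p) + x) ` (affine hull P)" if "x \<in> P" "y \<in> P" for x y
    proof -
      have "(- p + x) - (- p + y) \<in> (\<lambda>x. (- p) + x) ` (affine hull P)"
        using that by (intro subspace_diff[OF sub] imageI hull_inc)
      then show ?thesis by simp
    qed
    then have "directions P \<subseteq> (\<lambda>x. (- p) + x) ` (affine hull P)"
      unfolding directions_def by (intro span_minimal sub) auto
    then show ?thesis using that by auto
  qed
  obtain v where v: "v \<in> directions P" "\<And>w. w \<in> directions P \<Longrightarrow> (c - p) \<bullet> w = v \<bullet> w"
    using directions_component by metis
  define m where "m = p + v"
  have m: "m \<in> affine hull P" unfolding m_def by (rule hull[OF v(1)])
  have orth: "y \<bullet> (m - c) = 0" if "y \<in> directions P" for y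
    using v(2)[OF that] by (simp add: m_def inner_diff_right inner_diff_left inner_add_right inner_commute)
  show thesis
  proof (rule that[OF m orth])
    fix x assume "x \<in> affine hull P"
    then have "x - m \<in> directions P" using m by (rule affine_hull_diff_in_directions)
    then have 0: "(x - m) \<bullet> (m - c) = 0" by (rule orth)
    have "x - c = (x - m) + (m - c)" by simp
    then have "(norm (x - c))\<^sup>2 = ((x - m) + (m - c)) \<bullet> ((x - m) + (m - c))"
      by (simp only: power2_norm_eq_inner)
    also have "\<dots> = (norm (x - m))\<^sup>2 + (norm (m - c))\<^sup>2"
      unfolding power2_norm_eq_inner inner_add_left[of "x - m"] inner_add_right[of _ "x - m"]
      using 0 by (simp add: inner_commute[of "m - c" "x - m"])
    finally show "(norm (x - c))\<^sup>2 = (norm (x - m))\<^sup>2 + (norm (m - c))\<^sup>2" .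
  qed
qed

lemma sphere_iff_norm:
  "{v. v extreme_point_of P} \<subseteq> sphere c r \<longleftrightarrow> (\<forall>v. v extreme_point_of P \<longrightarrow> norm (v - c) = r)"
  by (auto simp: dist_norm norm_minus_commute)

lemma circumcenter_eqI:
  assumes "polytope P" "c \<in> affine hull P" "\<And>v. v extreme_point_of P \<Longrightarrow> norm (v - c) = r"
  shows "circumcenter P = c"
  unfolding circumcenter_def sphere_iff_norm
  by (rule the_equality) (use assms circumcenter_unique in blast)+

lemma inscribed_with_centerI:
  assumes "polytope P" "c \<in> affine hull P" "\<And>v. v extreme_point_of P \<Longrightarrow> norm (v - c) = r"
  shows "inscribed_with_center P c"
proof -
  have "P \<noteq> {}" using assms(2) by auto
  then show ?thesis
    using assms circumcenter_eqI[OF assms]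
    unfolding inscribed_with_center_def inscribed_def sphere_iff_norm by blast
qed

lemma inscribed_center:
  assumes "inscribed P"
  obtains r where "circumcenter P \<in> affine hull P"
    "\<And>v. v extreme_point_of P \<Longrightarrow> norm (v - circumcenter P) = r"
proof -
  obtain c r where P: "polytope P" "P \<noteq> {}" and c: "\<And>v. v extreme_point_of P \<Longrightarrow> norm (v - c) = r"
    using assms unfolding inscribed_def sphere_iff_norm by blast
  obtain m where m: "m \<in> affine hull P"
      "\<And>x. x \<in> affine hull P \<Longrightarrow> (norm (x - c))\<^sup>2 = (norm (x - m))\<^sup>2 + (norm (m - c))\<^sup>2"
    using orthogonal_center_in_affine_hull[OF P(2), of c] by metis
  have "norm (v - m) = sqrt (r\<^sup>2 - (norm (m - c))\<^sup>2)" if "v extreme_point_of P" for v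
  proof -
    have "v \<in> affine hull P" using that by (auto simp: extreme_point_of_def hull_inc)
    from m(2)[OF this] have "(norm (v - m))\<^sup>2 = r\<^sup>2 - (norm (m - c))\<^sup>2" using c[OF that] by simp
    then show ?thesis by (metis norm_ge_zero real_sqrt_unique)
  qed
  then show thesis using that circumcenter_eqI[OF P(1) m(1)] m(1) by metis
qed

lemma inscribed_with_center_norm:
  assumes "inscribed_with_center P c" "x extreme_point_of P" "y extreme_point_of P"
  shows "norm (x - c) = norm (y - c)"
  using assms inscribed_center unfolding inscribed_with_center_def by metis

section \<open>Bisectors and the projections onto them\<close>

lemma bisector_csegment:
  assumes "z \<noteq> 0"
  shows "bisector (csegment w z) = {x. z \<bullet> (x - w) = 0}"
proof -
  have "dist x (w - z) = dist x (w + z) \<longleftrightarrow> z \<bullet> (x - w) = 0" for x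
  proof -
    have "dist x (w - z) = dist x (w + z) \<longleftrightarrow> (norm ((x - w) + z))\<^sup>2 = (norm ((x - w) - z))\<^sup>2"
      by (simp add: dist_norm algebra_simps)
    also have "\<dots> \<longleftrightarrow> z \<bullet> (x - w) = 0"
      unfolding power2_norm_eq_inner inner_add_left[of "x - w"] inner_add_right[of _ "x - w"]
        inner_diff_left[of "x - w"] inner_diff_right[of _ "x - w"]
      by (simp add: inner_commute[of z "x - w"])
    finally show ?thesis .
  qed
  moreover have "bisector (csegment w z) = {x. dist x (w - z) = dist x (w + z)}"
    unfolding bisector_def closed_segment_eq doubleton_eq_iff by auto
  ultimately show ?thesis by simp
qed

lemma orth_proj_hyperplane:
  assumes "z \<noteq> 0"
  shows "orth_proj {x. z \<bullet> (x - c) = 0} = project_along c z"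
proof
  fix x
  show "orth_proj {x. z \<bullet> (x - c) = 0} x = project_along c z x"
    unfolding orth_proj_def
  proof (rule the_equality)
    have "orthogonal (x - project_along c z x) (u - project_along c z x)" if "z \<bullet> (u - c) = 0" for u
    proof -
      have "z \<bullet> ((u - c) - (project_along c z x - c)) = 0"
        unfolding inner_diff_right[of z "u - c"] using that inner_project_along[OF assms] by simp
      then have "z \<bullet> (u - project_along c z x) = 0" by simp
      then show ?thesis unfolding project_along_def[of c z x] orthogonal_def by simp
    qed
    then show "project_along c z x \<in> {x. z \<bullet> (x - c) = 0} \<and>
        (\<forall>u\<in>{x. z \<bullet> (x - c) = 0}. orthogonal (x - project_along c z x) (u - project_along c z x))"
      using inner_project_along[OF assms] by auto
    fix y assume y: "y \<in> {x. z \<bullet> (x - c) = 0} \<and> (\<forall>u\<in>{x. z \<bullet> (x - c) = 0}. orthogonal (x - y) (u - y))"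
    let ?p = "project_along c z x"
    \<comment> \<open>Both \<open>x - y\<close> and \<open>x - ?p\<close> are orthogonal to
      \<open>?p - y\<close>, and their difference is \<open>?p - y\<close>, which therefore
      vanishes.\<close>
    have "(x - y) \<bullet> (?p - y) = 0" using y inner_project_along[OF assms] by (auto simp: orthogonal_def)
    moreover have "z \<bullet> ((?p - c) - (y - c)) = 0"
      unfolding inner_diff_right[of z "?p - c"] using y inner_project_along[OF assms] by simp
    then have "z \<bullet> (?p - y) = 0" by simp
    then have "(x - ?p) \<bullet> (?p - y) = 0" by (simp add: project_along_def)
    moreover have "?p - y = (x - y) - (x - ?p)" by simp
    then have "(?p - y) \<bullet> (?p - y) = (x - y) \<bullet> (?p - y) - (x - ?p) \<bullet> (?p - y)"
      by (metis inner_diff_left)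
    ultimately show "y = ?p" by simp
  qed
qed

section \<open>The characterization\<close>

locale inscribed_polytope =
  fixes P :: "'a::euclidean_space set" and c r
  assumes polytope_P: "polytope P" and P_nonempty: "P \<noteq> {}" and center: "c \<in> affine hull P"
    and sphere: "\<And>v. v extreme_point_of P \<Longrightarrow> norm (v - c) = r"
begin

lemma edge_center:
  assumes "csegment w z edge_of P"
  shows "z \<bullet> (w - c) = 0" "(norm (w - c))\<^sup>2 + (norm z)\<^sup>2 = r\<^sup>2"
proof -
  have "norm (w - z - c) = r" "norm (w + z - c) = r"
    using edge_endpoints_extreme[OF assms] sphere by auto
  from csegment_center_orthogonal[OF this]
  show "z \<bullet> (w - c) = 0" "(norm (w - c))\<^sup>2 + (norm z)\<^sup>2 = r\<^sup>2" .
qed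

text \<open>The center is equidistant from both endpoints, so the bisector passes through it and may
  be based at \<open>c\<close> instead of \<open>w\<close>.\<close>

lemma bisector_edge:
  assumes "csegment w z edge_of P"
  shows "bisector (csegment w z) = {x. z \<bullet> (x - c) = 0}"
  unfolding bisector_csegment[OF csegment_edge_nonzero[OF assms]]
  using edge_center(1)[OF assms] by (auto simp: inner_diff_right)

lemma all_edges_iff: "(\<forall>e. e edge_of P \<longrightarrow> \<Phi> e) \<longleftrightarrow> (\<forall>w z. csegment w z edge_of P \<longrightarrow> \<Phi> (csegment w z))"
  using polytope_edge_segment[OF polytope_P] segment_eq_csegment by metis

lemma zonotope_imp_inscribed:
  assumes Z: "zonotope P" and e: "csegment w z edge_of P"
  shows "inscribed_with_center (project_along c z ` P) c"
    "project_along c z ` P = P \<inter> {x. z \<bullet> (x - c) = 0}"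
proof -
  have summand: "\<exists>Q. P = Q + closed_segment 0 v" if "closed_segment x (x + v) edge_of P" for x v
    using zonotope_edge_summand[OF Z that] .
  show "project_along c z ` P = P \<inter> {x. z \<bullet> (x - c) = 0}"
    by (rule projection_eq_section[OF polytope_P sphere summand e])
  \<comment> \<open>The points projected into the hull of the projection form an affine set that
    contains \<open>P\<close>, hence also \<open>c\<close>; and \<open>c\<close> is fixed, so it
    lies in that hull.\<close>
  let ?A = "{x. project_along c z x \<in> affine hull (project_along c z ` P)}"
  have "affine ?A"
  proof (unfold affine_def[of ?A], intro ballI allI impI)
    fix x y and s t :: real assume "x \<in> ?A" "y \<in> ?A" and st: "s + t = 1"
    then have "s *\<^sub>R project_along c z x + t *\<^sub>R project_along c z y \<in> affine hull (project_along c z ` P)"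
      by (intro mem_affine affine_affine_hull) auto
    then show "s *\<^sub>R x + t *\<^sub>R y \<in> ?A" by (simp add: project_along_affine[OF st])
  qed
  moreover have "P \<subseteq> ?A" by (blast intro: hull_inc)
  ultimately have "affine hull P \<subseteq> ?A" by (metis hull_minimal)
  then have "project_along c z c \<in> affine hull (project_along c z ` P)" using center by blast
  then have "c \<in> affine hull (project_along c z ` P)" by (simp add: project_along_id)
  moreover have "norm (p - c) = sqrt (r\<^sup>2 - (norm z)\<^sup>2)"
    if "p extreme_point_of (project_along c z ` P)" for p
  proof -
    have "(norm (p - c))\<^sup>2 = r\<^sup>2 - (norm z)\<^sup>2"
      by (rule project_along_edge(2)[OF polytope_P sphere summand e that])
    from real_sqrt_unique[OF this norm_ge_zero] show ?thesis by (rule sym)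
  qed
  ultimately show "inscribed_with_center (project_along c z ` P) c"
    by (intro inscribed_with_centerI polytope_project_along[OF polytope_P])
qed

text \<open>The center of a face is the foot of the perpendicular from \<open>c\<close>. For edge
  directions \<open>z\<close> of \<open>G\<close> the values \<open>z \<bullet> (x - m)\<close> and
  \<open>z \<bullet> (x - c)\<close> agree, and on \<open>G\<close> equal distances from
  \<open>c\<close> are equal distances from \<open>m\<close>; this carries the conditions from
  \<open>P\<close> to \<open>G\<close>.\<close>

lemma polygon_face:
  assumes G: "G face_of P" "aff_dim G = 2"
  obtains m s where "inscribed_polygon G m s" "\<And>y. y \<in> directions G \<Longrightarrow> y \<bullet> (m - c) = 0"
    "\<And>x. x \<in> G \<Longrightarrow> (norm (x - c))\<^sup>2 = (norm (x - m))\<^sup>2 + (norm (m - c))\<^sup>2"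
proof -
  have "G \<noteq> {}" using G by auto
  then obtain m where m: "m \<in> affine hull G" "\<And>y. y \<in> directions G \<Longrightarrow> y \<bullet> (m - c) = 0"
      "\<And>x. x \<in> affine hull G \<Longrightarrow> (norm (x - c))\<^sup>2 = (norm (x - m))\<^sup>2 + (norm (m - c))\<^sup>2"
    using orthogonal_center_in_affine_hull[of G c] by metis
  have "norm (v - m) = sqrt (r\<^sup>2 - (norm (m - c))\<^sup>2)" if v: "v extreme_point_of G" for v
  proof -
    have "v \<in> affine hull G" using v by (auto simp: extreme_point_of_def hull_inc)
    moreover have "norm (v - c) = r" using sphere v extreme_point_of_face[OF G(1)] by blast
    ultimately have "(norm (v - m))\<^sup>2 = r\<^sup>2 - (norm (m - c))\<^sup>2" using m(3) by force
    then show ?thesis by (metis norm_ge_zero real_sqrt_unique)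
  qed
  then have "inscribed_polygon G m (sqrt (r\<^sup>2 - (norm (m - c))\<^sup>2))"
    using G m(1) face_of_polytope_polytope[OF polytope_P] by unfold_locales auto
  then show thesis using that m(2,3) by (metis hull_inc)
qed

lemma edge_of_face: "G face_of P \<Longrightarrow> e edge_of G \<Longrightarrow> e edge_of P"
  using face_of_trans by (auto simp: edge_of_def)

text \<open>The midpoint \<open>w\<close> is a vertex of the projection, so the whole projection
  lies in the ball of radius \<open>norm (w - c)\<close> around \<open>c\<close>. By Pythagoras a
  vertex of \<open>P\<close>, at distance \<open>r\<close> from \<open>c\<close>, is then at least
  \<open>norm z\<close> away from the hyperplane.\<close>

lemma zonotope_if_projections_inscribed:
  assumes proj: "\<And>w z. csegment w z edge_of P \<Longrightarrow> inscribed_with_center (project_along c z ` P) c"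
  shows "zonotope P"
proof -
  have slab: "z \<bullet> z \<le> \<bar>z \<bullet> (v - c)\<bar>" if e: "csegment w z edge_of P" and v: "v extreme_point_of P" for w z v
  proof -
    let ?f = "project_along c z"
    have z0: "z \<noteq> 0" by (rule csegment_edge_nonzero[OF e])
    obtain u where u: "csegment w z = maxface P u"
      using polytope_face_eq_maxface[OF polytope_P] e
      by (metis edge_of_def ends_in_segment(1) empty_iff)
    have "w - z \<in> maxface P u" "w + z \<in> maxface P u" using u by auto
    from inner_maxface_eq[OF this] have uz: "u \<bullet> z = 0" by (simp add: inner_add_right inner_diff_right)
    then have uf: "u \<bullet> ?f x = u \<bullet> x" for x by (simp add: project_along_def inner_diff_right)
    have w: "w \<in> maxface P u" unfolding u[symmetric] in_csegment_iff by (intro exI[of _ 0]) simp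
    have fw: "?f w = w" using edge_center(1)[OF e] by (rule project_along_id)
    have f_edge: "?f x = w" if x: "x \<in> maxface P u" for x
    proof -
      obtain t where "x = w + t *\<^sub>R z" using x unfolding u[symmetric] in_csegment_iff by blast
      then show ?thesis using edge_center(1)[OF e] z0
        by (simp add: project_along_def inner_diff_right inner_add_right)
    qed
    \<comment> \<open>\<open>u\<close> exposes the edge and is unchanged by the projection, so on
      the projection it is maximal only at images of points of the edge, all of which collapse to
      \<open>w\<close>.\<close>
    have "w extreme_point_of ?f ` P"
      unfolding extreme_point_of_def
    proof (intro conjI ballI notI)
      show "w \<in> ?f ` P" using w fw maxface_subset by (metis image_eqI subsetD)
      fix a b assume *: "a \<in> ?f ` P" "b \<in> ?f ` P" "w \<in> open_segment a b"
      obtain a' b' where ab': "a' \<in> P" "b' \<in> P" "a = ?f a'" "b = ?f b'" using *(1,2) by blast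
      obtain t where t: "a \<noteq> b" "0 < t" "t < 1" "w = (1 - t) *\<^sub>R a + t *\<^sub>R b"
        using *(3) unfolding in_segment by blast
      note ab = ab' t
      have le: "u \<bullet> a' \<le> u \<bullet> w" "u \<bullet> b' \<le> u \<bullet> w" using w ab by (auto simp: maxface_def)
      have eq: "u \<bullet> w = (1 - t) * (u \<bullet> a') + t * (u \<bullet> b')"
        by (subst ab(8)) (simp add: inner_add_right ab(3,4) uf)
      have 0: "(1 - t) * (u \<bullet> w - u \<bullet> a') + t * (u \<bullet> w - u \<bullet> b') = 0"
        using eq by (simp add: algebra_simps)
      have "(1 - t) * (u \<bullet> w - u \<bullet> a') \<ge> 0" "t * (u \<bullet> w - u \<bullet> b') \<ge> 0"
        using le ab(6,7) by auto
      then have "(1 - t) * (u \<bullet> w - u \<bullet> a') = 0" "t * (u \<bullet> w - u \<bullet> b') = 0" using 0 by linarith+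
      then have "u \<bullet> a' = u \<bullet> w" "u \<bullet> b' = u \<bullet> w" using ab(6,7) by auto
      then have "a' \<in> maxface P u" "b' \<in> maxface P u"
        using maxface_memI[OF w ab(1)] maxface_memI[OF w ab(2)] by simp_all
      then have "a = b" unfolding ab(3,4) by (simp only: f_edge)
      then show False using ab(5) by contradiction
    qed
    then have "norm (p - c) = norm (w - c)" if "p extreme_point_of ?f ` P" for p
      using inscribed_with_center_norm[OF proj[OF e]] that by blast
    \<comment> \<open>A vertex of \<open>P\<close> need not project to a vertex, so only an upper
      bound for the distance of its image is available; the slab needs no more.\<close>
    then have "?f ` P \<subseteq> cball c (norm (w - c))"
      by (intro polytope_subset_if_extreme[OF polytope_project_along[OF polytope_P]])
        (auto simp: dist_norm norm_minus_commute)
    moreover have "v \<in> P" using v by (simp add: extreme_point_of_def)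
    ultimately have "norm (?f v - c) \<le> norm (w - c)" by (auto simp: dist_norm norm_minus_commute)
    then have "(norm (?f v - c))\<^sup>2 \<le> (norm (w - c))\<^sup>2" by (rule power_mono) simp
    moreover have "r\<^sup>2 = (norm (?f v - c))\<^sup>2 + (z \<bullet> (v - c))\<^sup>2 / (z \<bullet> z)"
      using norm_project_along[OF z0, of v c] sphere[OF v] by simp
    moreover have "r\<^sup>2 = (norm (w - c))\<^sup>2 + z \<bullet> z"
      using edge_center(2)[OF e] by (simp add: power2_norm_eq_inner[of z])
    ultimately have "z \<bullet> z \<le> (z \<bullet> (v - c))\<^sup>2 / (z \<bullet> z)" by linarith
    then have "(z \<bullet> z)\<^sup>2 \<le> (z \<bullet> (v - c))\<^sup>2" using z0 by (simp add: pos_le_divide_eq power2_eq_square)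
    then show ?thesis by (metis abs_le_square_iff abs_of_nonneg inner_ge_zero)
  qed
  have "zonal G" if G: "G face_of P" "aff_dim G = 2" for G
  proof -
    obtain m s where polygon: "inscribed_polygon G m s" "\<And>y. y \<in> directions G \<Longrightarrow> y \<bullet> (m - c) = 0"
      using polygon_face[OF G] by metis
    interpret inscribed_polygon G m s by (rule polygon(1))
    show ?thesis
    proof (rule zonal_if_slabs_avoid_vertices)
      fix w z v assume e: "csegment w z edge_of G" and v: "v extreme_point_of G"
      have "z \<bullet> z \<le> \<bar>z \<bullet> (v - c)\<bar>"
        using slab edge_of_face[OF G(1) e] v extreme_point_of_face[OF G(1)] by blast
      moreover have "z \<bullet> (m - c) = 0" by (rule polygon(2)[OF edge_in_directions[OF e]])
      ultimately show "z \<bullet> z \<le> \<bar>z \<bullet> (v - m)\<bar>" by (simp add: inner_diff_right)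
    qed
  qed
  then have "zonal P" by (rule zonal_if_2_faces_zonal[OF polytope_P])
  then show ?thesis by (rule zonal_imp_zonotope[OF polytope_P P_nonempty])
qed

text \<open>The edge meets its bisector only in the midpoint, which makes \<open>w\<close> a vertex
  of the section and fixes the common distance. Cutting a face of \<open>P\<close> by the bisector
  gives a face of the section, so the condition restricts to polygons.\<close>

lemma zonotope_if_sections_inscribed:
  assumes sect: "\<And>w z. csegment w z edge_of P \<Longrightarrow> inscribed_with_center (P \<inter> {x. z \<bullet> (x - c) = 0}) c"
  shows "zonotope P"
proof -
  have section_norm: "norm (x - c) = norm (w - c)"
    if e: "csegment w z edge_of P" and x: "x extreme_point_of (P \<inter> {x. z \<bullet> (x - c) = 0})" for w z x
  proof -
    have "csegment w z \<inter> {x. z \<bullet> (x - c) = 0} = {w}"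
    proof -
      have "z \<bullet> (w + t *\<^sub>R z - c) = t * (z \<bullet> z)" for t
        using edge_center(1)[OF e] by (simp add: inner_diff_right inner_add_right)
      then show ?thesis
        using csegment_edge_nonzero[OF e] edge_center(1)[OF e]
        by (auto simp: in_csegment_iff intro: exI[of _ "0::real"])
    qed
    moreover have "convex {x. z \<bullet> (x - c) = 0}"
      using convex_hyperplane[of z "z \<bullet> c"] by (simp add: inner_diff_right)
    then have "(csegment w z \<inter> {x. z \<bullet> (x - c) = 0}) face_of (P \<inter> {x. z \<bullet> (x - c) = 0})"
      using e by (intro face_of_slice) (auto simp: edge_of_def)
    ultimately have "w extreme_point_of (P \<inter> {x. z \<bullet> (x - c) = 0})"
      by (simp add: face_of_singleton)
    then show ?thesis using inscribed_with_center_norm[OF sect[OF e] x] by simp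
  qed
  have "zonal G" if G: "G face_of P" "aff_dim G = 2" for G
  proof -
    obtain m s where polygon: "inscribed_polygon G m s"
        "\<And>x. x \<in> G \<Longrightarrow> (norm (x - c))\<^sup>2 = (norm (x - m))\<^sup>2 + (norm (m - c))\<^sup>2"
      using polygon_face[OF G] by metis
    interpret inscribed_polygon G m s by (rule polygon(1))
    show ?thesis
    proof (rule zonal_if_sections_inscribed)
      fix w z x
      assume e: "csegment w z edge_of G" and x: "x extreme_point_of (G \<inter> {x. z \<bullet> (x - w) = 0})"
      note eP = edge_of_face[OF G(1) e]
      have H: "{x. z \<bullet> (x - w) = 0} = {x. z \<bullet> (x - c) = 0}"
        using edge_center(1)[OF eP] by (auto simp: inner_diff_right)
      have "convex {x. z \<bullet> (x - c) = 0}"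
        using convex_hyperplane[of z "z \<bullet> c"] by (simp add: inner_diff_right)
      then have "(G \<inter> {x. z \<bullet> (x - c) = 0}) face_of (P \<inter> {x. z \<bullet> (x - c) = 0})"
        using G(1) by (intro face_of_slice)
      then have "x extreme_point_of (P \<inter> {x. z \<bullet> (x - c) = 0})"
        using x extreme_point_of_face unfolding H by blast
      then have "norm (x - c) = norm (w - c)" by (rule section_norm[OF eP])
      moreover have "x \<in> G" "w \<in> G"
        using x edge_center_in[OF e] by (auto simp: extreme_point_of_def)
      ultimately have "(norm (x - m))\<^sup>2 = (norm (w - m))\<^sup>2" using polygon(2)[of x] polygon(2)[of w] by simp
      then show "norm (x - m) = norm (w - m)" by simp
    qed
  qed
  then have "zonal P" by (rule zonal_if_2_faces_zonal[OF polytope_P])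
  then show ?thesis by (rule zonal_imp_zonotope[OF polytope_P P_nonempty])
qed

end

theorem theorem1p1:
  fixes P :: "'a::euclidean_space set"
  assumes "inscribed P"
  shows "(zonotope P \<longleftrightarrow>
           (\<forall>e. e edge_of P \<longrightarrow>
              inscribed_with_center (orth_proj (bisector e) ` P) (circumcenter P))) \<and>
         (zonotope P \<longleftrightarrow>
           (\<forall>e. e edge_of P \<longrightarrow>
              inscribed_with_center (P \<inter> bisector e) (circumcenter P)))"
proof -
  obtain r where r: "circumcenter P \<in> affine hull P"
      "\<And>v. v extreme_point_of P \<Longrightarrow> norm (v - circumcenter P) = r"
    using inscribed_center[OF assms] by metis
  interpret inscribed_polytope P "circumcenter P" r
    using assms r by unfold_locales (auto simp: inscribed_def)
  have proj: "orth_proj (bisector (csegment w z)) ` P = project_along (circumcenter P) z ` P"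
    and sect: "P \<inter> bisector (csegment w z) = P \<inter> {x. z \<bullet> (x - circumcenter P) = 0}"
    if "csegment w z edge_of P" for w z
    unfolding bisector_edge[OF that] orth_proj_hyperplane[OF csegment_edge_nonzero[OF that]] by simp_all
  show ?thesis
    unfolding all_edges_iff
  proof (intro conjI iffI allI impI)
    fix w z assume Z: "zonotope P" and e: "csegment w z edge_of P"
    show "inscribed_with_center (orth_proj (bisector (csegment w z)) ` P) (circumcenter P)"
      unfolding proj[OF e] by (rule zonotope_imp_inscribed(1)[OF Z e])
    show "inscribed_with_center (P \<inter> bisector (csegment w z)) (circumcenter P)"
      unfolding sect[OF e] using zonotope_imp_inscribed[OF Z e] by simp
  next
    assume *: "\<forall>w z. csegment w z edge_of P \<longrightarrow>
      inscribed_with_center (orth_proj (bisector (csegment w z)) ` P) (circumcenter P)"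
    show "zonotope P"
      by (rule zonotope_if_projections_inscribed) (use * proj in metis)
  next
    assume *: "\<forall>w z. csegment w z edge_of P \<longrightarrow>
      inscribed_with_center (P \<inter> bisector (csegment w z)) (circumcenter P)"
    show "zonotope P"
      by (rule zonotope_if_sections_inscribed) (use * sect in metis)
  qed
qed

end
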